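(* Let $X_1,\ldots,X_n$ be geodesic Gromov hyperbolic spaces, with each boundary at infinity $\partial_\infty X_i$ endowed with a visual metric. Then $$\operatorname{asdim}(X_1\times\cdots\times X_n)\ge\operatorname{\ell-dim}\bigl(\partial_\infty X_1\times\cdots\times\partial_\infty X_n\times[0,1]^n\bigr).$$
   Context: Products of metric spaces carry the $l_\infty$-metric (the maximum of the distances in the factors). Hyperbolicity. For $o,x,x'$ in a metric space $X$, the Gromov product is $(x|x')_o=\frac12(|xo|+|x'o|-|xx'|)$. $X$ is $\delta$-hyperbolic if $(x|y)_o\ge\min\{(x|z)_o,(z|y)_o\}-\delta$ for all $o,x,y,z\in X$; it is (Gromov) hyperbolic if it is $\delta$-hyperbolic for some $\delta\ge0$. $\partial_\infty X$ is the Gromov boundary at infinity; the Gromov product based at $o$ extends in the standard way to $\partial_\infty X$. A metric $d$ on $\partial_\infty X$ is visual if there are $o\in X$, $a>1$ and constants $c_1,c_2>0$ with $c_1a^{-(\xi|\xi')_o}\le d(\xi,\xi')\le c_2a^{-(\xi|\xi')_o}$ for all $\xi,\xi'\in\partial_\infty X$. Coverings. For a family $\mathcal U$ of subsets of a metric space $Z$: $\operatorname{mesh}(\mathcal U)=\sup\{\operatorname{diam}U:U\in\mathcal U\}$; the multiplicity $m(\mathcal U)$ is the maximal number of members of $\mathcal U$ with nonempty intersection; $\mathcal U$ is disjoint if its members are pairwise disjoint; a covering is $m$-colored if it is the union of $m$ disjoint families. The Lebesgue number of an open covering $\mathcal U$ of $Z$ is $L(\mathcal U)=\inf_{z\in Z}\sup\{\operatorname{dist}(z,Z\setminus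 U):U\in\mathcal U\}$. Dimensions. $\operatorname{\ell-dim}(Z)$ (linearly controlled dimension) is the minimal integer $m\ge0$ for which there is $\delta\in(0,1)$ such that for every sufficiently small $\tau>0$ there is an $(m+1)$-colored open covering $\mathcal U$ of $Z$ with $\operatorname{mesh}(\mathcal U)\le\tau$ and $L(\mathcal U)\ge\delta\tau$. $\operatorname{asdim}X$ is the minimal integer $m\ge0$ such that for every $d>0$ there is an open covering $\mathcal U$ of $X$ with $m(\mathcal U)\le m+1$, $\operatorname{mesh}(\mathcal U)<\infty$ and $L(\mathcal U)\ge d$. Each is $\infty$ if no such $m$ exists. *)

theory Defs
  imports "HOL-Analysis.Analysis" "HOL-Library.Extended_Nat" "HOL-Library.Disjoint_Sets"
begin

section \<open>Products with the maximum metric\<close>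

text \<open>The library's binary product metric is the Euclidean combination of the two distances, so the
  maximum metric is introduced here, for two factors and for a finite family.\<close>

definition linf_prod2 :: "'a metric \<Rightarrow> 'b metric \<Rightarrow> ('a \<times> 'b) metric" where
  "linf_prod2 A B =
     metric (mspace A \<times> mspace B, \<lambda>p q. max (mdist A (fst p) (fst q)) (mdist B (snd p) (snd q)))"

text \<open>The inserted \<open>0\<close> only matters for the empty family; otherwise this is the maximum of
  the (nonnegative) distances in the factors.\<close>

definition linf_dist :: "'i set \<Rightarrow> ('i \<Rightarrow> 'a metric) \<Rightarrow> ('i \<Rightarrow> 'a) \<Rightarrow> ('i \<Rightarrow> 'a) \<Rightarrow> real" where
  "linf_dist I X x y = Max (insert 0 ((\<lambda>i. mdist (X i) (x i) (y i)) ` I))"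

definition linf_prod :: "'i set \<Rightarrow> ('i \<Rightarrow> 'a metric) \<Rightarrow> ('i \<Rightarrow> 'a) metric" where
  "linf_prod I X = metric (Pi\<^sub>E I (\<lambda>i. mspace (X i)), linf_dist I X)"

lemma Metric_space_linf_prod2:
  "Metric_space (mspace A \<times> mspace B)
     (\<lambda>p q. max (mdist A (fst p) (fst q)) (mdist B (snd p) (snd q)))"
proof
  fix p q r :: "'a \<times> 'b"
  show "0 \<le> max (mdist A (fst p) (fst q)) (mdist B (snd p) (snd q))"
    by (simp add: le_max_iff_disj)
  show "max (mdist A (fst p) (fst q)) (mdist B (snd p) (snd q)) =
        max (mdist A (fst q) (fst p)) (mdist B (snd q) (snd p))"
    by (simp add: mdist_commute)
  assume p: "p \<in> mspace A \<times> mspace B" and q: "q \<in> mspace A \<times> mspace B"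
  have "0 \<le> mdist A (fst p) (fst q)" "0 \<le> mdist B (snd p) (snd q)" by simp_all
  then have "max (mdist A (fst p) (fst q)) (mdist B (snd p) (snd q)) = 0 \<longleftrightarrow>
        mdist A (fst p) (fst q) = 0 \<and> mdist B (snd p) (snd q) = 0"
    by linarith
  then show "max (mdist A (fst p) (fst q)) (mdist B (snd p) (snd q)) = 0 \<longleftrightarrow> p = q"
    using p q by (auto simp: mem_Times_iff prod_eq_iff)
  assume r: "r \<in> mspace A \<times> mspace B"
  have "mdist A (fst p) (fst r) \<le> mdist A (fst p) (fst q) + mdist A (fst q) (fst r)"
    "mdist B (snd p) (snd r) \<le> mdist B (snd p) (snd q) + mdist B (snd q) (snd r)"
    using p q r by (auto intro: mdist_triangle)
  then show "max (mdist A (fst p) (fst r)) (mdist B (snd p) (snd r)) \<le>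
        max (mdist A (fst p) (fst q)) (mdist B (snd p) (snd q)) +
        max (mdist A (fst q) (fst r)) (mdist B (snd q) (snd r))"
    by linarith
qed

lemma mspace_linf_prod2 [simp]: "mspace (linf_prod2 A B) = mspace A \<times> mspace B"
  by (simp add: linf_prod2_def Metric_space.mspace_metric[OF Metric_space_linf_prod2])

lemma mdist_linf_prod2:
  "mdist (linf_prod2 A B) p q = max (mdist A (fst p) (fst q)) (mdist B (snd p) (snd q))"
  by (simp add: linf_prod2_def Metric_space.mdist_metric[OF Metric_space_linf_prod2])

lemma linf_dist_le_iff:
  assumes "finite I"
  shows "linf_dist I X x y \<le> c \<longleftrightarrow> 0 \<le> c \<and> (\<forall>i\<in>I. mdist (X i) (x i) (y i) \<le> c)"
  using assms by (simp add: linf_dist_def)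

lemma linf_dist_nonneg: "finite I \<Longrightarrow> 0 \<le> linf_dist I X x y"
  by (simp add: linf_dist_def)

lemma mdist_le_linf_dist:
  "finite I \<Longrightarrow> i \<in> I \<Longrightarrow> mdist (X i) (x i) (y i) \<le> linf_dist I X x y"
  by (simp add: linf_dist_def)

lemma Metric_space_linf_prod:
  assumes fin: "finite I"
  shows "Metric_space (Pi\<^sub>E I (\<lambda>i. mspace (X i))) (linf_dist I X)"
proof
  fix x y z :: "'a \<Rightarrow> 'b"
  show "0 \<le> linf_dist I X x y" by (rule linf_dist_nonneg[OF fin])
  show "linf_dist I X x y = linf_dist I X y x" by (simp add: linf_dist_def mdist_commute)
  assume x: "x \<in> Pi\<^sub>E I (\<lambda>i. mspace (X i))" and y: "y \<in> Pi\<^sub>E I (\<lambda>i. mspace (X i))"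
  have "linf_dist I X x y = 0 \<longleftrightarrow> linf_dist I X x y \<le> 0"
    using linf_dist_nonneg[OF fin, of X x y] by linarith
  also have "\<dots> \<longleftrightarrow> (\<forall>i\<in>I. x i = y i)"
    using x y by (auto simp: linf_dist_le_iff[OF fin] PiE_iff order_antisym_conv)
  also have "\<dots> \<longleftrightarrow> x = y"
    using x y by (auto intro: PiE_ext)
  finally show "linf_dist I X x y = 0 \<longleftrightarrow> x = y" .
  assume z: "z \<in> Pi\<^sub>E I (\<lambda>i. mspace (X i))"
  have "mdist (X i) (x i) (z i) \<le> linf_dist I X x y + linf_dist I X y z" if "i \<in> I" for i
  proof -
    have "mdist (X i) (x i) (z i) \<le> mdist (X i) (x i) (y i) + mdist (X i) (y i) (z i)"
      using x y z that by (auto intro!: mdist_triangle simp: PiE_iff)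
    then show ?thesis
      using mdist_le_linf_dist[OF fin that, of X x y] mdist_le_linf_dist[OF fin that, of X y z]
      by linarith
  qed
  then show "linf_dist I X x z \<le> linf_dist I X x y + linf_dist I X y z"
    by (simp add: linf_dist_le_iff[OF fin] linf_dist_nonneg[OF fin])
qed

lemma mspace_linf_prod:
  "finite I \<Longrightarrow> mspace (linf_prod I X) = Pi\<^sub>E I (\<lambda>i. mspace (X i))"
  by (simp add: linf_prod_def Metric_space.mspace_metric[OF Metric_space_linf_prod])

lemma mdist_linf_prod:
  "finite I \<Longrightarrow> mdist (linf_prod I X) = linf_dist I X"
  by (simp add: linf_prod_def Metric_space.mdist_metric[OF Metric_space_linf_prod])


section \<open>Geodesic and hyperbolic spaces\<close>

definition geodesic_metric :: "'a metric \<Rightarrow> bool" where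
  "geodesic_metric X \<longleftrightarrow>
     (\<forall>x\<in>mspace X. \<forall>y\<in>mspace X. \<exists>\<gamma>::real \<Rightarrow> 'a.
        \<gamma> ` {0..mdist X x y} \<subseteq> mspace X \<and> \<gamma> 0 = x \<and> \<gamma> (mdist X x y) = y \<and>
        (\<forall>s\<in>{0..mdist X x y}. \<forall>t\<in>{0..mdist X x y}. mdist X (\<gamma> s) (\<gamma> t) = \<bar>s - t\<bar>))"

definition gromov_product :: "'a metric \<Rightarrow> 'a \<Rightarrow> 'a \<Rightarrow> 'a \<Rightarrow> real" where
  "gromov_product X w x y = (mdist X x w + mdist X y w - mdist X x y) / 2"

definition delta_hyperbolic :: "real \<Rightarrow> 'a metric \<Rightarrow> bool" where
  "delta_hyperbolic \<delta> X \<longleftrightarrow>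
     (\<forall>w\<in>mspace X. \<forall>x\<in>mspace X. \<forall>y\<in>mspace X. \<forall>z\<in>mspace X.
        gromov_product X w x y \<ge> min (gromov_product X w x z) (gromov_product X w z y) - \<delta>)"

definition gromov_hyperbolic :: "'a metric \<Rightarrow> bool" where
  "gromov_hyperbolic X \<longleftrightarrow> (\<exists>\<delta>\<ge>0. delta_hyperbolic \<delta> X)"


section \<open>The boundary at infinity\<close>

text \<open>Boundary points are classes of sequences with \<open>(x\<^sub>i|x\<^sub>j)\<^sub>w \<rightarrow> \<infinity>\<close> as
  \<open>i, j \<rightarrow> \<infinity>\<close>, two of them being identified when \<open>(x\<^sub>i|y\<^sub>i)\<^sub>w \<rightarrow> \<infinity>\<close>.  Neither condition depends
  on the base point \<open>w\<close>; see \<open>conv_to_infinity_iff\<close> and \<open>equiv_at_infinity_iff\<close>.\<close>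

definition conv_to_infinity :: "'a metric \<Rightarrow> (nat \<Rightarrow> 'a) \<Rightarrow> bool" where
  "conv_to_infinity X x \<longleftrightarrow> range x \<subseteq> mspace X \<and>
     (\<exists>w\<in>mspace X. filterlim (\<lambda>(i, j). gromov_product X w (x i) (x j)) at_top
                     (sequentially \<times>\<^sub>F sequentially))"

definition equiv_at_infinity :: "'a metric \<Rightarrow> ((nat \<Rightarrow> 'a) \<times> (nat \<Rightarrow> 'a)) set" where
  "equiv_at_infinity X =
     {(x, y). conv_to_infinity X x \<and> conv_to_infinity X y \<and>
        (\<exists>w\<in>mspace X. filterlim (\<lambda>i. gromov_product X w (x i) (y i)) at_top sequentially)}"

definition gromov_boundary :: "'a metric \<Rightarrow> (nat \<Rightarrow> 'a) set set" where
  "gromov_boundary X = {x. conv_to_infinity X x} // equiv_at_infinity X"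

text \<open>The Gromov product on the boundary is the infimum of the lower limits over all
  representatives, with value \<open>\<infinity>\<close> on the diagonal.\<close>

definition boundary_gromov_product ::
    "'a metric \<Rightarrow> 'a \<Rightarrow> (nat \<Rightarrow> 'a) set \<Rightarrow> (nat \<Rightarrow> 'a) set \<Rightarrow> ereal" where
  "boundary_gromov_product X w \<xi> \<eta> =
     (INF x\<in>\<xi>. INF y\<in>\<eta>. liminf (\<lambda>i. ereal (gromov_product X w (x i) (y i))))"

text \<open>\<open>a\<^sup>-\<^sup>g\<close> with \<open>a\<^sup>-\<^sup>\<infinity> = 0\<close>; the value \<open>-\<infinity>\<close> does not occur since Gromov products are
  nonnegative.\<close>

definition exp_neg :: "real \<Rightarrow> ereal \<Rightarrow> real" where
  "exp_neg a g = (if g = \<infinity> then 0 else a powr (- real_of_ereal g))"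

definition visual_metric :: "'a metric \<Rightarrow> (nat \<Rightarrow> 'a) set metric \<Rightarrow> bool" where
  "visual_metric X D \<longleftrightarrow> mspace D = gromov_boundary X \<and>
     (\<exists>w\<in>mspace X. \<exists>a>1. \<exists>c1>0. \<exists>c2>0.
        \<forall>\<xi>\<in>gromov_boundary X. \<forall>\<eta>\<in>gromov_boundary X.
          c1 * exp_neg a (boundary_gromov_product X w \<xi> \<eta>) \<le> mdist D \<xi> \<eta> \<and>
          mdist D \<xi> \<eta> \<le> c2 * exp_neg a (boundary_gromov_product X w \<xi> \<eta>))"

lemma gromov_product_change_base:
  assumes "w \<in> mspace X" "w' \<in> mspace X" "x \<in> mspace X" "y \<in> mspace X"
  shows "gromov_product X w x y - mdist X w w' \<le> gromov_product X w' x y"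
proof -
  have "mdist X x w \<le> mdist X x w' + mdist X w' w" "mdist X y w \<le> mdist X y w' + mdist X w' w"
    using assms by (auto intro: mdist_triangle)
  then show ?thesis
    unfolding gromov_product_def mdist_commute[of X w' w] by argo
qed

lemma gromov_product_nonneg:
  assumes "w \<in> mspace X" "x \<in> mspace X" "y \<in> mspace X"
  shows "0 \<le> gromov_product X w x y"
  using mdist_triangle[of x X w y] assms
  by (simp add: gromov_product_def mdist_commute[of X w y])

lemma filterlim_gromov_product_change_base:
  assumes lim: "filterlim (\<lambda>k. gromov_product X w (f k) (g k)) at_top F"
    and "w \<in> mspace X" "w' \<in> mspace X" "\<And>k. f k \<in> mspace X" "\<And>k. g k \<in> mspace X"
  shows "filterlim (\<lambda>k. gromov_product X w' (f k) (g k)) at_top F"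
proof (rule filterlim_at_top_mono)
  show "filterlim (\<lambda>k. - mdist X w w' + gromov_product X w (f k) (g k)) at_top F"
    by (rule filterlim_tendsto_add_at_top[OF tendsto_const lim])
  show "\<forall>\<^sub>F k in F. - mdist X w w' + gromov_product X w (f k) (g k) \<le> gromov_product X w' (f k) (g k)"
    using gromov_product_change_base[of w X w' "f k" "g k" for k] assms(2-)
    by (intro always_eventually allI) (simp add: algebra_simps)
qed

lemma conv_to_infinity_iff:
  assumes w: "w \<in> mspace X"
  shows "conv_to_infinity X x \<longleftrightarrow> range x \<subseteq> mspace X \<and>
     filterlim (\<lambda>(i, j). gromov_product X w (x i) (x j)) at_top (sequentially \<times>\<^sub>F sequentially)"
  using w filterlim_gromov_product_change_base[of X _ "\<lambda>p. x (fst p)" "\<lambda>p. x (snd p)"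
      "sequentially \<times>\<^sub>F sequentially" w]
  by (auto simp: conv_to_infinity_def case_prod_unfold image_subset_iff)

lemma equiv_at_infinity_iff:
  assumes w: "w \<in> mspace X"
  shows "(x, y) \<in> equiv_at_infinity X \<longleftrightarrow> conv_to_infinity X x \<and> conv_to_infinity X y \<and>
     filterlim (\<lambda>i. gromov_product X w (x i) (y i)) at_top sequentially"
  using w filterlim_gromov_product_change_base[of X _ x y sequentially w]
  by (auto simp: equiv_at_infinity_def conv_to_infinity_def image_subset_iff)


section \<open>Coverings\<close>

definition open_covering :: "'a metric \<Rightarrow> 'a set set \<Rightarrow> bool" where
  "open_covering Z \<U> \<longleftrightarrow> (\<forall>U\<in>\<U>. openin (mtopology_of Z) U) \<and> \<Union>\<U> = mspace Z"

text \<open>Diameters, mesh, distances to sets and Lebesgue numbers take values in \<open>[0, \<infinity>]\<close>: unbounded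
  sets have infinite diameter, \<open>dist(z, \<emptyset>) = \<infinity>\<close>, and the supremum over the empty set is \<open>0\<close>.\<close>

definition ediam :: "'a metric \<Rightarrow> 'a set \<Rightarrow> ennreal" where
  "ediam Z U = (SUP x\<in>U. SUP y\<in>U. ennreal (mdist Z x y))"

definition mesh :: "'a metric \<Rightarrow> 'a set set \<Rightarrow> ennreal" where
  "mesh Z \<U> = (SUP U\<in>\<U>. ediam Z U)"

definition edist_set :: "'a metric \<Rightarrow> 'a \<Rightarrow> 'a set \<Rightarrow> ennreal" where
  "edist_set Z z S = (INF y\<in>S. ennreal (mdist Z z y))"

definition lebesgue_number :: "'a metric \<Rightarrow> 'a set set \<Rightarrow> ennreal" where
  "lebesgue_number Z \<U> = (INF z\<in>mspace Z. SUP U\<in>\<U>. edist_set Z z (mspace Z - U))"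

text \<open>Infinite subfamilies with nonempty intersection need no separate treatment: they contain
  finite ones of every size.\<close>

definition multiplicity :: "'a set set \<Rightarrow> enat" where
  "multiplicity \<U> = (SUP \<V>\<in>{\<V>. \<V> \<subseteq> \<U> \<and> finite \<V> \<and> \<Inter>\<V> \<noteq> {}}. enat (card \<V>))"

definition colored :: "nat \<Rightarrow> 'a set set \<Rightarrow> bool" where
  "colored m \<U> \<longleftrightarrow> (\<exists>\<F>::nat \<Rightarrow> 'a set set. (\<forall>k<m. disjoint (\<F> k)) \<and> \<U> = (\<Union>k<m. \<F> k))"


section \<open>Dimensions\<close>

text \<open>In \<^typ>\<open>enat\<close> the infimum of the empty set is \<open>\<infinity>\<close> and every nonempty set attains its
  infimum.\<close>

definition ell_dim :: "'a metric \<Rightarrow> enat" where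
  "ell_dim Z = Inf {enat m | m::nat. \<exists>\<delta>::real. 0 < \<delta> \<and> \<delta> < 1 \<and>
     (\<forall>\<^sub>F \<tau>::real in at_right 0. \<exists>\<U>. open_covering Z \<U> \<and> colored (m + 1) \<U> \<and>
        mesh Z \<U> \<le> ennreal \<tau> \<and> lebesgue_number Z \<U> \<ge> ennreal (\<delta> * \<tau>))}"

definition asdim :: "'a metric \<Rightarrow> enat" where
  "asdim X = Inf {enat m | m::nat. \<forall>d::real. d > 0 \<longrightarrow>
     (\<exists>\<U>. open_covering X \<U> \<and> multiplicity \<U> \<le> enat (m + 1) \<and>
        mesh X \<U> < \<infinity> \<and> lebesgue_number X \<U> \<ge> ennreal d)}"

end

theory Submission
  imports Defs
begin

text \<open>
  Let \<open>k\<close> be the asymptotic dimension of the product of the \<open>X\<^sub>i\<close>, and let \<open>\<U>\<close> be a bounded covering of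
  this product of multiplicity at most \<open>k + 1\<close> whose Lebesgue number exceeds a constant depending only on
  the hyperbolicity of the factors.  Coverings of the boundary side at all small scales \<open>\<tau>\<close> are obtained from
  this single covering by pulling it back.

  In one factor, consider the annulus \<open>R \<le> |x w| \<le> R + h\<close> around the base point \<open>w\<close>.  The map that sends
  a boundary point and a height to the corresponding point on a ray from \<open>w\<close> moves boundary points at
  distance a small multiple of \<open>a\<^sup>-\<^sup>R\<close> to points at bounded distance, and points of the annulus at distance at most
  \<open>M\<close> come from boundary points at distance at most a large multiple of \<open>a\<^sup>-\<^sup>R\<close>.  Choosing \<open>R\<close> with
  \<open>a\<^sup>-\<^sup>R\<close> proportional to \<open>\<tau>\<close> thus matches the fixed scale of \<open>\<U>\<close> with the scale \<open>\<tau>\<close>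
  in the boundary; this is \<open>ex_radial_chart\<close>.

  The interval \<open>[0, 1]\<close> is about \<open>1 / \<tau>\<close> units long at this scale, whereas the annulus has fixed
  thickness.  The interval is therefore folded into the annulus, going up and down once in each
  period of length \<open>\<tau>\<close>.  Folding is not injective, but if \<open>h\<close> is larger than the
  mesh \<open>M\<close> of \<open>\<U>\<close>, then each member of \<open>\<U>\<close> misses the lower or the upper end of the annulus, and its preimage falls
  apart into small pieces, one for each period.  Taking the pieces separately changes
  neither the multiplicity nor the Lebesgue number; see \<open>colored_covering_of_radial_charts\<close>, where this is
  done in all coordinates at once.

  The result is a covering of multiplicity \<open>k + 1\<close>, whereas the linearly controlled dimension asks for
  \<open>k + 1\<close> colors.  The barycentric subdivision of the nerve turns the former into the latter with
  a loss in the Lebesgue number that depends only on \<open>k\<close>; \<open>colored_open_covering_of_multiplicity\<close> carries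
  this out with explicit sets.
\<close>

section \<open>Colored coverings from coverings of bounded multiplicity\<close>

lemma mdist_self [simp]: "z \<in> mspace Z \<Longrightarrow> mdist Z z z = 0"
  by simp

text \<open>The distance from \<open>z\<close> to the complement of \<open>V\<close>, truncated at \<open>\<rho>\<close> so that it is
  a real number even when \<open>V\<close> is the whole space.\<close>

definition depth :: "'z metric \<Rightarrow> real \<Rightarrow> 'z set \<Rightarrow> 'z \<Rightarrow> real" where
  "depth Z \<rho> V z = Inf (insert \<rho> (mdist Z z ` (mspace Z - V)))"

lemma bdd_below_distances: "bdd_below (insert \<rho> (mdist Z z ` S))"
  by (rule bdd_belowI[of _ "min 0 \<rho>"]) (auto simp: min_le_iff_disj)

lemma depth_le_dist:
  assumes "y \<in> mspace Z" "y \<notin> V"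
  shows "depth Z \<rho> V z \<le> mdist Z z y"
  unfolding depth_def using assms by (intro cInf_lower bdd_below_distances) auto

lemma depth_le_cap: "depth Z \<rho> V z \<le> \<rho>"
  unfolding depth_def by (intro cInf_lower bdd_below_distances) auto

lemma depth_eq_cap:
  assumes "\<And>y. y \<in> mspace Z \<Longrightarrow> mdist Z z y < \<rho> \<Longrightarrow> y \<in> V"
  shows "depth Z \<rho> V z = \<rho>"
proof (rule antisym[OF depth_le_cap])
  show "\<rho> \<le> depth Z \<rho> V z"
    unfolding depth_def using assms by (intro cInf_greatest) (auto intro!: leI)
qed

lemma depth_lipschitz:
  assumes "z \<in> mspace Z" "y \<in> mspace Z"
  shows "depth Z \<rho> V z \<le> depth Z \<rho> V y + mdist Z z y"
proof -
  have "depth Z \<rho> V z - mdist Z z y \<le> t" if t: "t \<in> insert \<rho> (mdist Z y ` (mspace Z - V))" for t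
  proof (cases "t = \<rho>")
    case True
    then show ?thesis using depth_le_cap[of Z \<rho> V z] mdist_nonneg[of Z z y] by linarith
  next
    case False
    then obtain x where x: "x \<in> mspace Z" "x \<notin> V" "t = mdist Z y x" using t by auto
    show ?thesis
      using depth_le_dist[OF x(1,2), of \<rho> z] mdist_triangle[OF assms x(1)] x(3) by linarith
  qed
  then have "depth Z \<rho> V z - mdist Z z y \<le> depth Z \<rho> V y"
    unfolding depth_def[of Z \<rho> V y] by (intro cInf_greatest) auto
  then show ?thesis by linarith
qed

lemma depth_pos_imp_mem:
  assumes "z \<in> mspace Z" "0 < depth Z \<rho> V z"
  shows "z \<in> V"
  using depth_le_dist[of z Z V \<rho> z] assms by force

text \<open>The values of \<open>f\<close> on \<open>T\<close> that lie between \<open>0\<close> and \<open>\<rho>\<close> cut this interval into at most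
  \<open>card T\<close> pieces, so some piece has length at least \<open>\<epsilon>\<close>; the indices whose value lies above it
  form the set \<open>S\<close>.  The induction removes an index \<open>j\<close> with value below \<open>\<epsilon>\<close> and lowers all other
  values by \<open>\<epsilon>\<close>: the gap found after lowering either is still there, or begins at \<open>f j\<close>.\<close>

lemma ex_top_set_with_gap:
  fixes f :: "'i \<Rightarrow> real"
  assumes "finite T" "real (card T) * \<epsilon> \<le> \<rho>" "\<exists>i\<in>T. f i \<ge> \<rho>" "0 < \<epsilon>"
  shows "\<exists>S\<subseteq>T. S \<noteq> {} \<and> (\<forall>i\<in>S. \<epsilon> \<le> f i) \<and> (\<forall>i\<in>S. \<forall>j\<in>T - S. f j + \<epsilon> \<le> f i)"
  using assms
proof (induction "card T" arbitrary: T \<rho> f)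
  case 0
  then show ?case by auto
next
  case (Suc n)
  show ?case
  proof (cases "\<forall>i\<in>T. \<epsilon> \<le> f i")
    case True
    then show ?thesis using Suc.prems by (intro exI[of _ T]) auto
  next
    case False
    then obtain j where j: "j \<in> T" "f j < \<epsilon>" by auto
    have n: "n = card (T - {j})" using Suc.hyps Suc.prems j by simp
    have c: "real (card T) = real n + 1" using Suc.hyps(2) by simp
    have eps: "real n * \<epsilon> \<le> \<rho> - \<epsilon>" using Suc.prems(2) by (simp add: c algebra_simps)
    moreover have "0 \<le> real n * \<epsilon>" using Suc.prems(4) by simp
    ultimately have "\<epsilon> \<le> \<rho>" by linarith
    then have "\<exists>i\<in>T - {j}. f i - \<epsilon> \<ge> \<rho> - \<epsilon>" using Suc.prems(3) j by force
    then obtain S where S: "S \<subseteq> T - {j}" "S \<noteq> {}" "\<forall>i\<in>S. \<epsilon> \<le> f i - \<epsilon>"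
      "\<forall>i\<in>S. \<forall>k\<in>T - {j} - S. f k - \<epsilon> + \<epsilon> \<le> f i - \<epsilon>"
      using Suc.hyps(1)[OF n, of "\<rho> - \<epsilon>" "\<lambda>i. f i - \<epsilon>"] Suc.prems eps n by auto
    show ?thesis
    proof (intro exI conjI ballI)
      show "S \<subseteq> T" "S \<noteq> {}" using S by auto
      show "\<epsilon> \<le> f i" if "i \<in> S" for i using S(3) that Suc.prems(4) by force
      show "f k + \<epsilon> \<le> f i" if "i \<in> S" "k \<in> T - S" for i k
      proof (cases "k = j")
        case True
        have "\<epsilon> \<le> f i - \<epsilon>" using S(3) that by blast
        then show ?thesis using j by (simp add: True)
      next
        case False
        then have "f k - \<epsilon> + \<epsilon> \<le> f i - \<epsilon>" using S(4) that by blast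
        then show ?thesis by linarith
      qed
    qed
  qed
qed

text \<open>The points at which the indices in \<open>S\<close> have positive values exceeding all other values by a definite
  margin.  For the partition of unity of a covering this is, up to the margin, the preimage of the
  open star of the vertex \<open>S\<close> in the barycentric subdivision of the nerve.\<close>

definition dominance_region :: "'z metric \<Rightarrow> ('i \<Rightarrow> 'z \<Rightarrow> real) \<Rightarrow> 'i set \<Rightarrow> 'i set \<Rightarrow> 'z set" where
  "dominance_region Z f I S = {z \<in> mspace Z. \<exists>\<epsilon>>0.
     (\<forall>i\<in>S. \<epsilon> \<le> f i z) \<and> (\<forall>i\<in>S. \<forall>j\<in>I - S. f j z + \<epsilon> \<le> f i z)}"

text \<open>Two different sets of the same size each contain an index that the other lacks, and at a common
  point each of these two indices would have to dominate the other.  The size of \<open>S\<close> can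
  therefore serve as a color.\<close>

lemma dominance_region_disjoint:
  assumes "S \<subseteq> I" "S' \<subseteq> I" "finite S" "finite S'" "card S = card S'" "S \<noteq> S'"
  shows "dominance_region Z f I S \<inter> dominance_region Z f I S' = {}"
proof (rule ccontr)
  assume "\<not> ?thesis"
  then obtain z where z: "z \<in> dominance_region Z f I S" "z \<in> dominance_region Z f I S'" by auto
  have "\<not> S \<subseteq> S'" "\<not> S' \<subseteq> S" using assms by (auto dest: card_subset_eq)
  then obtain i j where ij: "i \<in> S" "i \<notin> S'" "j \<in> S'" "j \<notin> S" by auto
  obtain e where "e > 0" "f j z + e \<le> f i z"
    using z(1) ij assms(2) unfolding dominance_region_def by blast
  moreover obtain e' where "e' > 0" "f i z + e' \<le> f j z"
    using z(2) ij assms(1) unfolding dominance_region_def by blast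
  ultimately show False by linarith
qed

lemma ball_subset_dominance_region:
  assumes lip: "\<And>i y z. y \<in> mspace Z \<Longrightarrow> z \<in> mspace Z \<Longrightarrow> f i z \<le> f i y + mdist Z z y"
    and z: "z \<in> mspace Z" and y: "y \<in> mspace Z" "mdist Z z y < \<epsilon> / 2"
    and pos: "\<forall>i\<in>S. \<epsilon> \<le> f i z" and gap: "\<forall>i\<in>S. \<forall>j\<in>I - S. f j z + \<epsilon> \<le> f i z"
  shows "y \<in> dominance_region Z f I S"
proof -
  define e where "e = \<epsilon> - 2 * mdist Z z y"
  have d: "0 \<le> mdist Z z y" by simp
  have "e > 0" using y(2) by (simp add: e_def)
  moreover have "e \<le> f i y" if "i \<in> S" for i
  proof -
    have "\<epsilon> \<le> f i z" using pos that by blast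
    then show ?thesis using lip[OF y(1) z, of i] d unfolding e_def by linarith
  qed
  moreover have "f j y + e \<le> f i y" if "i \<in> S" "j \<in> I - S" for i j
  proof -
    have "f j z + \<epsilon> \<le> f i z" using gap that by blast
    then show ?thesis
      using lip[OF y(1) z, of i] lip[OF z y(1), of j] mdist_commute[of Z z y] unfolding e_def
      by linarith
  qed
  ultimately show ?thesis using y(1) unfolding dominance_region_def by blast
qed

lemma openin_mtopology_of_iff:
  "openin (mtopology_of Z) U \<longleftrightarrow>
     U \<subseteq> mspace Z \<and> (\<forall>z\<in>U. \<exists>r>0. \<forall>y\<in>mspace Z. mdist Z z y < r \<longrightarrow> y \<in> U)"
proof -
  interpret Metric_space "mspace Z" "mdist Z" by (rule Metric_space_mspace_mdist)
  have "(\<exists>r>0. mball z r \<subseteq> U) \<longleftrightarrow> (\<exists>r>0. \<forall>y\<in>mspace Z. mdist Z z y < r \<longrightarrow> y \<in> U)"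
    if "z \<in> mspace Z" for z
    using that by (simp add: subset_iff Ball_def imp_conjL)
  then show ?thesis
    unfolding mtopology_of_def openin_mtopology by (simp add: subset_iff Ball_def imp_conjL) blast
qed

lemma openin_dominance_region:
  assumes lip: "\<And>i y z. y \<in> mspace Z \<Longrightarrow> z \<in> mspace Z \<Longrightarrow> f i z \<le> f i y + mdist Z z y"
  shows "openin (mtopology_of Z) (dominance_region Z f I S)"
  unfolding openin_mtopology_of_iff
proof (intro conjI ballI)
  show "dominance_region Z f I S \<subseteq> mspace Z" by (auto simp: dominance_region_def)
  fix z assume "z \<in> dominance_region Z f I S"
  then obtain e where e: "e > 0" "z \<in> mspace Z" "\<forall>i\<in>S. e \<le> f i z"
      "\<forall>i\<in>S. \<forall>j\<in>I - S. f j z + e \<le> f i z"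
    by (auto simp: dominance_region_def)
  show "\<exists>r>0. \<forall>y\<in>mspace Z. mdist Z z y < r \<longrightarrow> y \<in> dominance_region Z f I S"
    using ball_subset_dominance_region[OF lip e(2) _ _ e(3,4)] e(1)
    by (intro exI[of _ "e / 2"]) auto
qed

text \<open>The colors are the sizes \<open>1, \<dots>, m\<close> of the index sets of dominance regions of the depth functions.
  At every point at most \<open>m\<close> depths are positive and one of them equals \<open>\<rho>\<close>, so there is a gap of
  size \<open>\<rho> / m\<close> among them, and a ball of half that radius stays in the same dominance region because
  depths are 1-Lipschitz.  The sets \<open>V i\<close> need not be open, which matters because they will be
  preimages under a discontinuous map.\<close>

proposition colored_open_covering_of_multiplicity:
  fixes Z :: "'z metric" and V :: "'i \<Rightarrow> 'z set"
  assumes \<rho>: "0 < \<rho>" and m: "0 < m"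
    and ball: "\<And>z. z \<in> mspace Z \<Longrightarrow> \<exists>i\<in>I. \<forall>y\<in>mspace Z. mdist Z z y < \<rho> \<longrightarrow> y \<in> V i"
    and mult: "\<And>z. z \<in> mspace Z \<Longrightarrow> finite {i\<in>I. z \<in> V i} \<and> card {i\<in>I. z \<in> V i} \<le> m"
    and diam: "\<And>i x y. i \<in> I \<Longrightarrow> x \<in> V i \<Longrightarrow> y \<in> V i \<Longrightarrow> x \<in> mspace Z \<Longrightarrow> y \<in> mspace Z
                 \<Longrightarrow> mdist Z x y \<le> \<tau>"
  shows "\<exists>\<U>. open_covering Z \<U> \<and> colored m \<U> \<and> mesh Z \<U> \<le> ennreal \<tau> \<and>
           ennreal (\<rho> / (2 * real m)) \<le> lebesgue_number Z \<U>"
proof -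
  define f where "f = (\<lambda>i. depth Z \<rho> (V i))"
  define \<epsilon> where "\<epsilon> = \<rho> / real m"
  define \<F> where "\<F> = (\<lambda>k. dominance_region Z f I ` {S. S \<subseteq> I \<and> finite S \<and> card S = Suc k})"
  define \<U> where "\<U> = (\<Union>k<m. \<F> k)"
  have \<epsilon>: "0 < \<epsilon>" using \<rho> m by (simp add: \<epsilon>_def)
  have lip: "f i z \<le> f i y + mdist Z z y" if "y \<in> mspace Z" "z \<in> mspace Z" for i y z
    unfolding f_def using that by (intro depth_lipschitz)
  have ball_in: "\<exists>U\<in>\<U>. \<forall>y\<in>mspace Z. mdist Z z y < \<epsilon> / 2 \<longrightarrow> y \<in> U" if z: "z \<in> mspace Z" for z
  proof -
    define T where "T = {i\<in>I. z \<in> V i}"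
    have T: "finite T" "card T \<le> m" using mult[OF z] by (auto simp: T_def)
    obtain i where i: "i \<in> I" "\<forall>y\<in>mspace Z. mdist Z z y < \<rho> \<longrightarrow> y \<in> V i" using ball[OF z] by blast
    have "f i z = \<rho>" unfolding f_def using i(2) by (intro depth_eq_cap) auto
    moreover have "i \<in> T" using i z \<rho> by (simp add: T_def)
    ultimately have ex: "\<exists>i\<in>T. \<rho> \<le> f i z" by force
    have "real (card T) * \<epsilon> \<le> real m * \<epsilon>" using T \<epsilon> by (intro mult_right_mono) auto
    also have "\<dots> = \<rho>" using m by (simp add: \<epsilon>_def)
    finally obtain S where S: "S \<subseteq> T" "S \<noteq> {}" "\<forall>i\<in>S. \<epsilon> \<le> f i z"
        "\<forall>i\<in>S. \<forall>j\<in>T - S. f j z + \<epsilon> \<le> f i z"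
      using ex_top_set_with_gap[OF T(1) _ ex \<epsilon>] by blast
    have "f j z + \<epsilon> \<le> f i z" if "i \<in> S" "j \<in> I - S" for i j
    proof (cases "j \<in> T")
      case True
      then show ?thesis using S(4) that by blast
    next
      case False
      then have "f j z \<le> 0"
        using depth_pos_imp_mem[OF z, of \<rho> "V j"] that unfolding f_def T_def
        by (intro leI) auto
      moreover have "\<epsilon> \<le> f i z" using S(3) that by blast
      ultimately show ?thesis using \<epsilon> by linarith
    qed
    then have gap: "\<forall>i\<in>S. \<forall>j\<in>I - S. f j z + \<epsilon> \<le> f i z" by blast
    have fS: "finite S" "S \<subseteq> I" using S T by (auto simp: T_def dest: finite_subset)
    have "card S \<noteq> 0" using S(2) fS by simp
    moreover have "card S \<le> m" using card_mono[OF T(1) S(1)] T(2) by simp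
    ultimately have "\<exists>k<m. card S = Suc k" by (intro exI[of _ "card S - 1"]) auto
    then obtain k where k: "k < m" "card S = Suc k" by blast
    then have "dominance_region Z f I S \<in> \<F> k" using fS by (simp add: \<F>_def)
    then have "dominance_region Z f I S \<in> \<U>" using k(1) by (auto simp: \<U>_def)
    moreover have "y \<in> dominance_region Z f I S" if "y \<in> mspace Z" "mdist Z z y < \<epsilon> / 2" for y
      by (rule ball_subset_dominance_region[where f = f and Z = Z and I = I and S = S, OF lip z that S(3) gap])
    ultimately show ?thesis by blast
  qed
  have "open_covering Z \<U>"
    unfolding open_covering_def
  proof (intro conjI ballI equalityI subsetI)
    show "openin (mtopology_of Z) U" if "U \<in> \<U>" for U
    proof -
      have "openin (mtopology_of Z) (dominance_region Z f I S)" for S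
        by (rule openin_dominance_region) (rule lip)
      then show ?thesis using that by (auto simp: \<U>_def \<F>_def)
    qed
    show "z \<in> mspace Z" if "z \<in> \<Union>\<U>" for z
      using that by (auto simp: \<U>_def \<F>_def dominance_region_def)
    show "z \<in> \<Union>\<U>" if "z \<in> mspace Z" for z
    proof -
      have "mdist Z z z < \<epsilon> / 2" using that \<epsilon> by simp
      then show ?thesis using ball_in[OF that] that by blast
    qed
  qed
  moreover have "colored m \<U>"
    unfolding colored_def
  proof (intro exI[of _ \<F>] conjI allI impI)
    show "disjoint (\<F> k)" for k
    proof (rule disjointI)
      fix A B assume "A \<in> \<F> k" "B \<in> \<F> k" "A \<noteq> B"
      obtain S where S: "S \<subseteq> I" "finite S" "card S = Suc k" "A = dominance_region Z f I S"
        using \<open>A \<in> \<F> k\<close> unfolding \<F>_def by blast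
      obtain S' where S': "S' \<subseteq> I" "finite S'" "card S' = Suc k" "B = dominance_region Z f I S'"
        using \<open>B \<in> \<F> k\<close> unfolding \<F>_def by blast
      have "S \<noteq> S'" using \<open>A \<noteq> B\<close> S(4) S'(4) by blast
      then show "A \<inter> B = {}"
        unfolding S(4) S'(4) using S S' by (intro dominance_region_disjoint) simp_all
    qed
  qed (simp add: \<U>_def)
  moreover have "mesh Z \<U> \<le> ennreal \<tau>"
    unfolding mesh_def ediam_def
  proof (intro SUP_least ennreal_leI)
    fix U x y assume U: "U \<in> \<U>" and xy: "x \<in> U" "y \<in> U"
    obtain S where S: "S \<subseteq> I" "card S \<noteq> 0" "U = dominance_region Z f I S"
      using U unfolding \<U>_def \<F>_def by auto
    have "S \<noteq> {}" using S(2) by auto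
    then obtain i where i: "i \<in> S" by blast
    have "0 < f i u \<and> u \<in> mspace Z" if "u \<in> U" for u
      using that i unfolding S(3) dominance_region_def by fastforce
    then have "0 < f i x" "0 < f i y" "x \<in> mspace Z" "y \<in> mspace Z"
      using xy by blast+
    then show "mdist Z x y \<le> \<tau>"
      using diam[of i x y] depth_pos_imp_mem[of x Z \<rho> "V i"] depth_pos_imp_mem[of y Z \<rho> "V i"] i S(1)
      by (auto simp: f_def)
  qed
  moreover have "ennreal (\<rho> / (2 * real m)) \<le> lebesgue_number Z \<U>"
    unfolding lebesgue_number_def
  proof (rule INF_greatest)
    fix z assume "z \<in> mspace Z"
    then obtain U where U: "U \<in> \<U>" "\<forall>y\<in>mspace Z. mdist Z z y < \<epsilon> / 2 \<longrightarrow> y \<in> U"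
      using ball_in by blast
    have "ennreal (\<rho> / (2 * real m)) = ennreal (\<epsilon> / 2)" by (simp add: \<epsilon>_def mult.commute)
    also have "\<dots> \<le> edist_set Z z (mspace Z - U)"
      unfolding edist_set_def
    proof (intro INF_greatest ennreal_leI)
      fix y assume "y \<in> mspace Z - U"
      then show "\<epsilon> / 2 \<le> mdist Z z y" using U(2) by (intro leI) auto
    qed
    finally show "ennreal (\<rho> / (2 * real m)) \<le> (SUP U\<in>\<U>. edist_set Z z (mspace Z - U))"
      by (rule SUP_upper2[OF U(1)])
  qed
  ultimately show ?thesis by blast
qed

section \<open>Radial charts of a geodesic hyperbolic space\<close>

lemma gromov_product_commute: "gromov_product X w x y = gromov_product X w y x"
  by (simp add: gromov_product_def mdist_commute add.commute)

lemma gromov_product_self: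
  "x \<in> mspace X \<Longrightarrow> gromov_product X w x x = mdist X x w"
  by (simp add: gromov_product_def)

lemma delta_hyperbolicD:
  assumes "delta_hyperbolic \<delta> X" "w \<in> mspace X" "x \<in> mspace X" "y \<in> mspace X" "z \<in> mspace X"
    and "K \<le> gromov_product X w x z" "K \<le> gromov_product X w z y"
  shows "K - \<delta> \<le> gromov_product X w x y"
proof -
  have "min (gromov_product X w x z) (gromov_product X w z y) - \<delta> \<le> gromov_product X w x y"
    using assms(1-5) unfolding delta_hyperbolic_def by blast
  then show ?thesis using assms(6,7) by linarith
qed

text \<open>In a space that is not proper there may be no geodesic ray towards a given boundary point.  A point
  at distance \<open>r\<close> from \<open>w\<close> on a geodesic to a sufficiently late member of the sequence
  is an adequate substitute for the point at time \<open>r\<close> on such a ray.\<close>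

lemma ex_point_towards_infinity:
  assumes geo: "geodesic_metric X" and hyp: "delta_hyperbolic \<delta> X" and w: "w \<in> mspace X"
    and x: "conv_to_infinity X x" and r: "0 \<le> r"
  shows "\<exists>q\<in>mspace X. mdist X q w = r \<and> (\<forall>\<^sub>F i in sequentially. r - \<delta> \<le> gromov_product X w q (x i))"
proof -
  have xX: "x i \<in> mspace X" for i using x by (auto simp: conv_to_infinity_def)
  have "\<forall>\<^sub>F (i, j) in sequentially \<times>\<^sub>F sequentially. r \<le> gromov_product X w (x i) (x j)"
    using x w unfolding conv_to_infinity_iff[OF w] filterlim_at_top by (auto simp: case_prod_unfold)
  then obtain N where N: "\<And>i j. N \<le> i \<Longrightarrow> N \<le> j \<Longrightarrow> r \<le> gromov_product X w (x i) (x j)"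
    unfolding eventually_prod_sequentially by auto
  define L where "L = mdist X w (x N)"
  have rL: "r \<le> L" using N[of N N] by (simp add: gromov_product_self xX L_def mdist_commute)
  obtain \<gamma> :: "real \<Rightarrow> 'a" where \<gamma>: "\<gamma> ` {0..L} \<subseteq> mspace X" "\<gamma> 0 = w" "\<gamma> L = x N"
      and iso: "\<forall>s\<in>{0..L}. \<forall>t\<in>{0..L}. mdist X (\<gamma> s) (\<gamma> t) = \<bar>s - t\<bar>"
    using geo[unfolded geodesic_metric_def, THEN bspec, OF w, THEN bspec, OF xX[of N], folded L_def]
    by (elim exE conjE)
  have q: "\<gamma> r \<in> mspace X" using \<gamma>(1) r rL by auto
  have qw: "mdist X (\<gamma> r) w = r" using iso[THEN bspec, of r, THEN bspec, of 0] r rL by (simp add: \<gamma>(2))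
  have "mdist X (\<gamma> r) (x N) = L - r" using iso[THEN bspec, of r, THEN bspec, of L] r rL by (simp add: \<gamma>(3))
  then have qx: "gromov_product X w (\<gamma> r) (x N) = r"
    by (simp add: gromov_product_def qw L_def mdist_commute[of X w])
  have "r - \<delta> \<le> gromov_product X w (\<gamma> r) (x i)" if "N \<le> i" for i
    using N[of N i] that qx by (intro delta_hyperbolicD[OF hyp w q xX xX]) auto
  then show ?thesis using q qw unfolding eventually_sequentially by blast
qed

text \<open>Beyond what equivalence says about a class, the generating sequence \<open>x\<close> must itself lie in it: this is
  the diagonal case of the convergence of \<open>(x\<^sub>i|x\<^sub>j)\<^sub>w\<close>.\<close>

lemma ex_representative:
  assumes "\<xi> \<in> gromov_boundary X" and w: "w \<in> mspace X"
  shows "\<exists>x\<in>\<xi>. conv_to_infinity X x \<and>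
           (\<forall>y\<in>\<xi>. (\<forall>i. y i \<in> mspace X) \<and> filterlim (\<lambda>i. gromov_product X w (x i) (y i)) at_top sequentially)"
proof -
  obtain x where x: "conv_to_infinity X x" "\<xi> = equiv_at_infinity X `` {x}"
    using assms(1) unfolding gromov_boundary_def by (auto elim: quotientE)
  have "filterlim (\<lambda>i. gromov_product X w (x i) (x i)) at_top sequentially"
    unfolding filterlim_at_top
  proof
    fix K
    have "\<forall>\<^sub>F (i, j) in sequentially \<times>\<^sub>F sequentially. K \<le> gromov_product X w (x i) (x j)"
      using x(1) unfolding conv_to_infinity_iff[OF w] filterlim_at_top by (auto simp: case_prod_unfold)
    then show "\<forall>\<^sub>F i in sequentially. K \<le> gromov_product X w (x i) (x i)"
      unfolding eventually_prod_sequentially eventually_sequentially by auto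
  qed
  then have "x \<in> \<xi>" using x by (simp add: equiv_at_infinity_iff[OF w])
  moreover have "(\<forall>i. y i \<in> mspace X) \<and> filterlim (\<lambda>i. gromov_product X w (x i) (y i)) at_top sequentially"
    if "y \<in> \<xi>" for y
  proof -
    have "(x, y) \<in> equiv_at_infinity X" using that x(2) by simp
    then show ?thesis by (auto simp: equiv_at_infinity_iff[OF w] conv_to_infinity_def)
  qed
  ultimately show ?thesis using x(1) by blast
qed

text \<open>Up to the error \<open>\<delta>\<close>, the point \<open>q\<close> is where a ray from \<open>w\<close> to \<open>\<xi>\<close> would be at time \<open>r\<close>.  One good
  representative \<open>x\<close> is enough, since every other member of the class stays arbitrarily close to
  it in terms of Gromov products.\<close>

definition shadows :: "'a metric \<Rightarrow> 'a \<Rightarrow> real \<Rightarrow> (nat \<Rightarrow> 'a) set \<Rightarrow> real \<Rightarrow> 'a \<Rightarrow> bool" where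
  "shadows X w \<delta> \<xi> r q \<longleftrightarrow> q \<in> mspace X \<and> mdist X q w = r \<and>
     (\<exists>x\<in>\<xi>. (\<forall>i. x i \<in> mspace X) \<and>
        (\<forall>\<^sub>F i in sequentially. r - \<delta> \<le> gromov_product X w q (x i)) \<and>
        (\<forall>y\<in>\<xi>. (\<forall>i. y i \<in> mspace X) \<and>
           filterlim (\<lambda>i. gromov_product X w (x i) (y i)) at_top sequentially))"

lemma shadows_mem: "shadows X w \<delta> \<xi> r q \<Longrightarrow> q \<in> mspace X"
  and shadows_dist: "shadows X w \<delta> \<xi> r q \<Longrightarrow> mdist X q w = r"
  unfolding shadows_def by blast+

lemma ex_shadows:
  assumes "geodesic_metric X" "delta_hyperbolic \<delta> X" "w \<in> mspace X" "\<xi> \<in> gromov_boundary X" "0 \<le> r"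
  shows "\<exists>q. shadows X w \<delta> \<xi> r q"
proof -
  obtain x where x: "x \<in> \<xi>" "conv_to_infinity X x"
    "\<forall>y\<in>\<xi>. (\<forall>i. y i \<in> mspace X) \<and> filterlim (\<lambda>i. gromov_product X w (x i) (y i)) at_top sequentially"
    using ex_representative[OF assms(4,3)] by blast
  obtain q where "q \<in> mspace X" "mdist X q w = r"
      "\<forall>\<^sub>F i in sequentially. r - \<delta> \<le> gromov_product X w q (x i)"
    using ex_point_towards_infinity[OF assms(1-3) x(2) assms(5)] by blast
  then show ?thesis using x unfolding shadows_def conv_to_infinity_def image_subset_iff by blast
qed

text \<open>Two rays whose end points have Gromov product at least \<open>K\<close> fellow-travel up to time \<open>K\<close>.\<close>

lemma shadows_close:
  assumes hyp: "delta_hyperbolic \<delta> X" and \<delta>: "0 \<le> \<delta>" and w: "w \<in> mspace X"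
    and q: "shadows X w \<delta> \<xi> r q" and p: "shadows X w \<delta> \<eta> s p"
    and g: "ereal K \<le> boundary_gromov_product X w \<xi> \<eta>" and K: "r \<le> K" "s \<le> K"
  shows "mdist X q p \<le> \<bar>r - s\<bar> + (6 * \<delta> + 2)"
proof -
  obtain x where x: "x \<in> \<xi>" "\<forall>i. x i \<in> mspace X"
      "\<forall>\<^sub>F i in sequentially. r - \<delta> \<le> gromov_product X w q (x i)"
    using q unfolding shadows_def by blast
  obtain y where y: "y \<in> \<eta>" "\<forall>i. y i \<in> mspace X"
      "\<forall>\<^sub>F i in sequentially. s - \<delta> \<le> gromov_product X w p (y i)"
    using p unfolding shadows_def by blast
  \<comment> \<open>The lower limit bounds the products only up to an arbitrarily small loss; a loss of \<open>1\<close> suffices.\<close>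
  have "ereal (K - 1) < ereal K" by simp
  also have "\<dots> \<le> liminf (\<lambda>i. ereal (gromov_product X w (x i) (y i)))"
    by (rule order_trans[OF g]) (unfold boundary_gromov_product_def, intro INF_lower2[OF x(1)] INF_lower2[OF y(1)] order_refl)
  finally have "\<forall>\<^sub>F i in sequentially. ereal (K - 1) < ereal (gromov_product X w (x i) (y i))"
    by (rule less_LiminfD)
  then have "\<forall>\<^sub>F i in sequentially. r - \<delta> \<le> gromov_product X w q (x i) \<and>
      s - \<delta> \<le> gromov_product X w p (y i) \<and> K - 1 < gromov_product X w (x i) (y i)"
    using x(3) y(3) by eventually_elim auto
  then obtain i where i: "r - \<delta> \<le> gromov_product X w q (x i)"
      "s - \<delta> \<le> gromov_product X w p (y i)" "K - 1 < gromov_product X w (x i) (y i)"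
    using eventually_happens'[OF sequentially_bot] by blast
  have mem: "x i \<in> mspace X" "y i \<in> mspace X" "q \<in> mspace X" "p \<in> mspace X"
    using x y shadows_mem[OF q] shadows_mem[OF p] by auto
  define m where "m = min r s - 1 - \<delta>"
  have m: "m \<le> gromov_product X w q (x i)" "m \<le> gromov_product X w (x i) (y i)"
      "m - \<delta> \<le> gromov_product X w (y i) p"
    using i K \<delta> unfolding m_def gromov_product_commute[of X w "y i" p] by linarith+
  have "m - \<delta> \<le> gromov_product X w q (y i)"
    by (rule delta_hyperbolicD[OF hyp w mem(3,2,1) m(1,2)])
  then have "m - \<delta> - \<delta> \<le> gromov_product X w q p"
    by (rule delta_hyperbolicD[OF hyp w mem(3,4,2) _ m(3)])
  moreover have "mdist X q w = r" "mdist X p w = s" using shadows_dist[OF q] shadows_dist[OF p] by auto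
  ultimately have "2 * (min r s - 1 - 3 * \<delta>) \<le> r + s - mdist X q p"
    by (simp add: gromov_product_def m_def)
  then show ?thesis by (simp add: min_def abs_if split: if_splits)
qed

text \<open>Conversely, rays that come close at a late time have end points with large Gromov product.  The
  boundary product is an infimum over all representatives, and passing from the good ones to
  arbitrary ones costs two of the four hyperbolicity steps.\<close>

lemma shadows_far:
  assumes hyp: "delta_hyperbolic \<delta> X" and \<delta>: "0 \<le> \<delta>" and w: "w \<in> mspace X"
    and q: "shadows X w \<delta> \<xi> r q" and p: "shadows X w \<delta> \<eta> s p"
    and K: "K \<le> gromov_product X w q p" "K \<le> r" "K \<le> s"
  shows "ereal (K - 5 * \<delta>) \<le> boundary_gromov_product X w \<xi> \<eta>"
  unfolding boundary_gromov_product_def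
proof (intro INF_greatest)
  fix x' y' assume xy': "x' \<in> \<xi>" "y' \<in> \<eta>"
  obtain x where x: "\<forall>i. x i \<in> mspace X" "\<forall>i. x' i \<in> mspace X"
      "\<forall>\<^sub>F i in sequentially. r - \<delta> \<le> gromov_product X w q (x i)"
      "filterlim (\<lambda>i. gromov_product X w (x i) (x' i)) at_top sequentially"
    using q xy' unfolding shadows_def by blast
  obtain y where y: "\<forall>i. y i \<in> mspace X" "\<forall>i. y' i \<in> mspace X"
      "\<forall>\<^sub>F i in sequentially. s - \<delta> \<le> gromov_product X w p (y i)"
      "filterlim (\<lambda>i. gromov_product X w (y i) (y' i)) at_top sequentially"
    using p xy' unfolding shadows_def by blast
  have "\<forall>\<^sub>F i in sequentially. K \<le> gromov_product X w (x i) (x' i)"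
       "\<forall>\<^sub>F i in sequentially. K \<le> gromov_product X w (y i) (y' i)"
    using x(4) y(4) unfolding filterlim_at_top by blast+
  with x(3) y(3) have "\<forall>\<^sub>F i in sequentially. ereal (K - 5 * \<delta>) \<le> ereal (gromov_product X w (x' i) (y' i))"
  proof eventually_elim
    case (elim i)
    have mem: "x i \<in> mspace X" "y i \<in> mspace X" "q \<in> mspace X" "p \<in> mspace X"
        "x' i \<in> mspace X" "y' i \<in> mspace X"
      using x y shadows_mem[OF q] shadows_mem[OF p] by auto
    have "K - \<delta> \<le> gromov_product X w q (x i)" "K - \<delta> \<le> gromov_product X w (x i) (x' i)"
        "K - \<delta> \<le> gromov_product X w p (y i)" "K - \<delta> \<le> gromov_product X w (y i) (y' i)"
        "K - \<delta> - \<delta> \<le> gromov_product X w q p"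
      using elim K \<delta> by linarith+
    note le = this
    have 1: "K - \<delta> - \<delta> \<le> gromov_product X w q (x' i)"
      by (rule delta_hyperbolicD[OF hyp w mem(3,5,1) le(1,2)])
    have "K - \<delta> - \<delta> \<le> gromov_product X w p (y' i)"
      by (rule delta_hyperbolicD[OF hyp w mem(4,6,2) le(3,4)])
    then have 2: "K - \<delta> - \<delta> - \<delta> \<le> gromov_product X w q (y' i)"
      by (rule delta_hyperbolicD[OF hyp w mem(3,6,4) le(5)])
    have "K - \<delta> - \<delta> - \<delta> \<le> gromov_product X w (x' i) q"
      using 1 \<delta> unfolding gromov_product_commute[of X w "x' i" q] by linarith
    from delta_hyperbolicD[OF hyp w mem(5,6,3) this 2]
    show ?case using \<delta> by simp
  qed
  then show "ereal (K - 5 * \<delta>) \<le> liminf (\<lambda>i. ereal (gromov_product X w (x' i) (y' i)))"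
    by (rule Liminf_bounded)
qed

lemma exp_neg_le_powr:
  assumes "1 < a" "ereal K \<le> g"
  shows "exp_neg a g \<le> a powr (- K)"
  using assms by (cases g) (auto simp: exp_neg_def)

lemma exp_neg_le_powrD:
  assumes "1 < a" "0 < K" "exp_neg a g \<le> a powr (- K)"
  shows "ereal K \<le> g"
proof (cases g)
  case MInf
  have "a powr (- K) < 1" using powr_less_mono[of "- K" 0 a] assms by simp
  then show ?thesis using assms(1,3) MInf by (simp add: exp_neg_def)
qed (use assms in \<open>auto simp: exp_neg_def\<close>)

text \<open>\<open>p \<xi> r\<close> stands for the point on the ray to \<open>\<xi>\<close> at height \<open>r\<close> in an annulus of thickness \<open>h\<close>, whose
  inner radius is adapted to the scale \<open>\<tau>\<close> on the boundary.  Heights are 1-Lipschitz; boundary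
  points within \<open>\<epsilon>\<close> of each other give points whose distance exceeds the difference of the heights by at most \<open>C\<close>;
  points at distance at most \<open>M\<close> come from boundary points at distance at most \<open>\<tau>\<close>.\<close>

definition radial_chart ::
    "'a metric \<Rightarrow> 'b metric \<Rightarrow> real \<Rightarrow> real \<Rightarrow> real \<Rightarrow> real \<Rightarrow> real \<Rightarrow> ('b \<Rightarrow> real \<Rightarrow> 'a) \<Rightarrow> bool"
  where "radial_chart X D C M h \<epsilon> \<tau> p \<longleftrightarrow>
    (\<forall>\<xi>\<in>mspace D. \<forall>r\<in>{0..h}. p \<xi> r \<in> mspace X) \<and>
    (\<forall>\<xi>\<in>mspace D. \<forall>\<eta>\<in>mspace D. \<forall>r\<in>{0..h}. \<forall>s\<in>{0..h}.
       \<bar>r - s\<bar> \<le> mdist X (p \<xi> r) (p \<eta> s) \<and>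
       (mdist D \<xi> \<eta> \<le> \<epsilon> \<longrightarrow> mdist X (p \<xi> r) (p \<eta> s) \<le> \<bar>r - s\<bar> + C) \<and>
       (mdist X (p \<xi> r) (p \<eta> s) \<le> M \<longrightarrow> mdist D \<xi> \<eta> \<le> \<tau>))"

text \<open>The order of the quantifiers is the point: \<open>C\<close> depends only on the hyperbolicity constant, so it can be fixed
  before a covering of the space with large Lebesgue number is chosen; the mesh of that
  covering then gives \<open>M\<close> and \<open>h\<close>; and the ratio \<open>\<kappa>\<close> of the two boundary scales does not depend on \<open>\<tau>\<close>.\<close>

lemma ex_radial_chart:
  assumes geo: "geodesic_metric X" and hyp: "gromov_hyperbolic X" and vis: "visual_metric X D"
  shows "\<exists>C\<ge>0. \<forall>M\<ge>0. \<forall>h>0. \<exists>\<kappa>>0. \<forall>\<^sub>F \<tau> in at_right 0. \<exists>p. radial_chart X D C M h (\<kappa> * \<tau>) \<tau> p"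
proof -
  obtain \<delta> where \<delta>: "0 \<le> \<delta>" "delta_hyperbolic \<delta> X" using hyp by (auto simp: gromov_hyperbolic_def)
  from vis have D: "mspace D = gromov_boundary X" unfolding visual_metric_def by (rule conjunct1)
  from vis obtain w a c1 c2 where w: "w \<in> mspace X" and a: "1 < a" and c: "0 < c1" "0 < c2"
    and cmp: "\<forall>\<xi>\<in>mspace D. \<forall>\<eta>\<in>mspace D.
        c1 * exp_neg a (boundary_gromov_product X w \<xi> \<eta>) \<le> mdist D \<xi> \<eta> \<and>
        mdist D \<xi> \<eta> \<le> c2 * exp_neg a (boundary_gromov_product X w \<xi> \<eta>)"
    unfolding visual_metric_def D by auto
  have lower: "c1 * exp_neg a (boundary_gromov_product X w \<xi> \<eta>) \<le> mdist D \<xi> \<eta>"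
    and upper: "mdist D \<xi> \<eta> \<le> c2 * exp_neg a (boundary_gromov_product X w \<xi> \<eta>)"
    if "\<xi> \<in> mspace D" "\<eta> \<in> mspace D" for \<xi> \<eta>
    using cmp that by simp_all
  show ?thesis
  proof (rule exI[of _ "6 * \<delta> + 2"], intro conjI allI impI)
    show "0 \<le> 6 * \<delta> + 2" using \<delta>(1) by simp
  next
    fix M h :: real assume M: "0 \<le> M" and h: "0 < h"
    define b where "b = M / 2 + 5 * \<delta>"
    define \<kappa> where "\<kappa> = c1 / c2 * a powr (- (b + h))"
    have \<kappa>: "\<kappa> > 0" using a c by (simp add: \<kappa>_def)
    have b: "0 \<le> b" using M \<delta> by (simp add: b_def)
    have "\<exists>p. radial_chart X D (6 * \<delta> + 2) M h (\<kappa> * \<tau>) \<tau> p" if \<tau>: "0 < \<tau>" "\<tau> < c2" for \<tau>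
    proof -
      \<comment> \<open>The inner radius: \<open>c2 * a powr (- (R - b)) = \<tau>\<close>, where \<open>b\<close> is the loss in \<open>shadows_far\<close>.\<close>
      define R where "R = log a (c2 / \<tau>) + b"
      have "0 \<le> log a (c2 / \<tau>)" using \<tau> a by simp
      then have R: "0 \<le> R" using b by (simp add: R_def)
      have "a powr (log a (c2 / \<tau>)) = c2 / \<tau>" using \<tau> c a by simp
      then have powr_R: "a powr (- (R - b)) = \<tau> / c2" by (simp add: R_def powr_minus)
      have "\<kappa> * \<tau> = c1 * (a powr (- (R - b)) * a powr (- (b + h)))"
        unfolding powr_R by (simp add: \<kappa>_def)
      also have "a powr (- (R - b)) * a powr (- (b + h)) = a powr (- (R + h))"
        by (simp add: powr_add[symmetric])
      finally have eps: "\<kappa> * \<tau> = c1 * a powr (- (R + h))" .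
      define p where "p = (\<lambda>\<xi> r. SOME q. shadows X w \<delta> \<xi> (R + r) q)"
      have p: "shadows X w \<delta> \<xi> (R + r) (p \<xi> r)" if "\<xi> \<in> mspace D" "0 \<le> r" for \<xi> r
      proof -
        have "\<exists>q. shadows X w \<delta> \<xi> (R + r) q"
          using that R D by (intro ex_shadows[OF geo \<delta>(2) w]) auto
        then show ?thesis unfolding p_def by (rule someI_ex)
      qed
      have "radial_chart X D (6 * \<delta> + 2) M h (\<kappa> * \<tau>) \<tau> p"
        unfolding radial_chart_def
      proof (intro conjI ballI impI)
        fix \<xi> r assume "\<xi> \<in> mspace D" "r \<in> {0..h}"
        then show "p \<xi> r \<in> mspace X" using shadows_mem[OF p] by simp
      next
        fix \<xi> \<eta> r s assume as: "\<xi> \<in> mspace D" "\<eta> \<in> mspace D" "r \<in> {0..h}" "s \<in> {0..h}"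
        have rs: "0 \<le> r" "r \<le> h" "0 \<le> s" "s \<le> h" using as by auto
        note pr = p[OF as(1) rs(1)] and ps = p[OF as(2) rs(3)]
        have mem: "p \<xi> r \<in> mspace X" "p \<eta> s \<in> mspace X"
          and rad: "mdist X (p \<xi> r) w = R + r" "mdist X (p \<eta> s) w = R + s"
          using shadows_mem[OF pr] shadows_mem[OF ps] shadows_dist[OF pr] shadows_dist[OF ps] by auto
        show "\<bar>r - s\<bar> \<le> mdist X (p \<xi> r) (p \<eta> s)"
          using mdist_triangle[OF mem(1,2) w] mdist_triangle[OF mem(2,1) w] rad
            mdist_commute[of X "p \<xi> r" "p \<eta> s"] by linarith
        show "mdist X (p \<xi> r) (p \<eta> s) \<le> \<bar>r - s\<bar> + (6 * \<delta> + 2)" if "mdist D \<xi> \<eta> \<le> \<kappa> * \<tau>"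
        proof -
          have "c1 * exp_neg a (boundary_gromov_product X w \<xi> \<eta>) \<le> c1 * a powr (- (R + h))"
            using lower[OF as(1,2)] that eps by simp
          then have "exp_neg a (boundary_gromov_product X w \<xi> \<eta>) \<le> a powr (- (R + h))"
            using c by simp
          then have "ereal (R + h) \<le> boundary_gromov_product X w \<xi> \<eta>"
            using R h by (intro exp_neg_le_powrD[OF a]) auto
          from shadows_close[OF \<delta>(2,1) w pr ps this] show ?thesis using rs by simp
        qed
        show "mdist D \<xi> \<eta> \<le> \<tau>" if "mdist X (p \<xi> r) (p \<eta> s) \<le> M"
        proof -
          have "R - M / 2 \<le> gromov_product X w (p \<xi> r) (p \<eta> s)"
            using that rad rs by (simp add: gromov_product_def)
          from shadows_far[OF \<delta>(2,1) w pr ps this]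
          have "ereal (R - b) \<le> boundary_gromov_product X w \<xi> \<eta>"
            using rs M by (simp add: b_def diff_diff_eq)
          then have "exp_neg a (boundary_gromov_product X w \<xi> \<eta>) \<le> \<tau> / c2"
            using exp_neg_le_powr[OF a, of "R - b"] unfolding powr_R by simp
          then have "c2 * exp_neg a (boundary_gromov_product X w \<xi> \<eta>) \<le> \<tau>"
            using c by (simp add: field_simps)
          then show ?thesis using upper[OF as(1,2)] by linarith
        qed
      qed
      then show ?thesis by blast
    qed
    then have "\<forall>\<^sub>F \<tau> in at_right 0. \<exists>p. radial_chart X D (6 * \<delta> + 2) M h (\<kappa> * \<tau>) \<tau> p"
      using c(2) unfolding eventually_at_right_field by blast
    then show "\<exists>\<kappa>>0. \<forall>\<^sub>F \<tau> in at_right 0. \<exists>p. radial_chart X D (6 * \<delta> + 2) M h (\<kappa> * \<tau>) \<tau> p"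
      using \<kappa> by blast
  qed
qed

section \<open>Pulling a covering back along a folding map\<close>

text \<open>A zigzag of period \<open>P\<close> between \<open>0\<close> and \<open>h\<close>: it is \<open>0\<close> at the multiples of \<open>P\<close> and \<open>h\<close> halfway between them.
  Any Lipschitz function with these properties would do.\<close>

definition fold_height :: "real \<Rightarrow> real \<Rightarrow> real \<Rightarrow> real" where
  "fold_height h P t = h * (1 - cos (2 * pi * (t / P))) / 2"

lemma fold_height_bounds:
  assumes "0 \<le> h"
  shows "fold_height h P t \<in> {0..h}"
proof -
  have "0 \<le> h * (1 - cos (2 * pi * (t / P)))" using assms by (intro mult_nonneg_nonneg) auto
  moreover have "h * (1 - cos (2 * pi * (t / P))) \<le> h * 2"
    using assms cos_ge_minus_one[of "2 * pi * (t / P)"] by (intro mult_left_mono) linarith+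
  ultimately show ?thesis by (simp add: fold_height_def)
qed

lemma abs_cos_diff_le: "\<bar>cos x - cos y\<bar> \<le> \<bar>x - y\<bar>" for x y :: real
proof -
  have "\<bar>cos x - cos y\<bar> = 2 * \<bar>sin ((x + y) / 2)\<bar> * \<bar>sin ((y - x) / 2)\<bar>"
    by (simp add: cos_diff_cos abs_mult)
  also have "\<dots> \<le> 2 * 1 * \<bar>(y - x) / 2\<bar>"
    by (intro mult_mono abs_sin_x_le_abs_x) auto
  finally show ?thesis by simp
qed

lemma fold_height_lipschitz:
  assumes "0 \<le> h" "0 < P"
  shows "\<bar>fold_height h P s - fold_height h P t\<bar> \<le> h * pi / P * \<bar>s - t\<bar>"
proof -
  have eq: "fold_height h P s - fold_height h P t = h / 2 * (cos (2 * pi * (t / P)) - cos (2 * pi * (s / P)))"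
  proof -
    have "h * (1 - u) / 2 - h * (1 - v) / 2 = h / 2 * (v - u)" for u v :: real
      by (simp add: field_simps)
    then show ?thesis unfolding fold_height_def .
  qed
  have "\<bar>fold_height h P s - fold_height h P t\<bar> = h / 2 * \<bar>cos (2 * pi * (t / P)) - cos (2 * pi * (s / P))\<bar>"
    unfolding eq abs_mult using assms by simp
  also have "\<dots> \<le> h / 2 * \<bar>2 * pi * (t / P) - 2 * pi * (s / P)\<bar>"
    using assms by (intro mult_left_mono abs_cos_diff_le) auto
  also have "2 * pi * (t / P) - 2 * pi * (s / P) = 2 * pi / P * (t - s)"
    by (simp add: algebra_simps diff_divide_distrib)
  also have "h / 2 * \<bar>2 * pi / P * (t - s)\<bar> = h * pi / P * \<bar>s - t\<bar>"
    using assms by (simp add: abs_mult abs_minus_commute)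
  finally show ?thesis .
qed

lemma fold_height_at_int:
  assumes "t / P \<in> \<int>"
  shows "fold_height h P t = 0"
proof -
  obtain j where j: "t / P = of_int j" using assms by (elim Ints_cases)
  have "cos (2 * pi * (t / P)) = 1"
    unfolding cos_one_2pi_int by (rule exI[of _ j]) (simp add: j)
  then show ?thesis unfolding fold_height_def by (simp only:) simp
qed

lemma fold_height_at_half_int:
  assumes "t / P - 1 / 2 \<in> \<int>"
  shows "fold_height h P t = h"
proof -
  obtain j where j: "t / P - 1 / 2 = of_int j" using assms by (elim Ints_cases)
  have "2 * pi * (t / P) = 2 * pi * of_int j + pi"
    unfolding j[symmetric] by (simp add: algebra_simps)
  then have "cos (2 * pi * (t / P)) = - cos (2 * pi * of_int j)" by simp
  also have "cos (2 * pi * of_int j :: real) = 1"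
    unfolding cos_one_2pi_int by (rule exI[of _ j]) simp
  finally show ?thesis unfolding fold_height_def by (simp only:) simp
qed

lemma floor_neq_imp_int_between:
  fixes u v :: real
  assumes "\<lfloor>u\<rfloor> \<noteq> \<lfloor>v\<rfloor>"
  shows "\<exists>w\<in>\<int>. w \<in> {min u v..max u v}"
proof (cases "u \<le> v")
  case True
  then have "\<lfloor>u\<rfloor> < \<lfloor>v\<rfloor>" using floor_mono[OF True] assms by simp
  then have "u < of_int \<lfloor>v\<rfloor>" by (simp add: floor_less_iff)
  then show ?thesis using True by (intro bexI[of _ "of_int \<lfloor>v\<rfloor>"]) auto
next
  case False
  then have "\<lfloor>v\<rfloor> < \<lfloor>u\<rfloor>" using floor_mono[of v u] assms by simp
  then have "v < of_int \<lfloor>u\<rfloor>" by (simp add: floor_less_iff)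
  then show ?thesis using False by (intro bexI[of _ "of_int \<lfloor>u\<rfloor>"]) auto
qed

lemma floor_eq_imp_abs_diff_less:
  fixes s t P b :: real
  assumes "0 < P" "\<lfloor>s / P - b\<rfloor> = \<lfloor>t / P - b\<rfloor>"
  shows "\<bar>s - t\<bar> < P"
proof -
  have "\<bar>(s / P - b) - (t / P - b)\<bar> < 1" using assms(2) by linarith
  then have "\<bar>(s - t) / P\<bar> < 1" by (simp add: diff_divide_distrib)
  then show ?thesis using assms(1) by simp
qed

lemma multiplicity_leD:
  assumes "multiplicity \<U> \<le> enat m"
  shows "finite {U\<in>\<U>. y \<in> U} \<and> card {U\<in>\<U>. y \<in> U} \<le> m"
proof (rule finite_if_finite_subsets_card_bdd)
  fix G assume G: "G \<subseteq> {U\<in>\<U>. y \<in> U}" "finite G"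
  then have "enat (card G) \<le> multiplicity \<U>"
    unfolding multiplicity_def by (intro SUP_upper) auto
  also have "\<dots> \<le> enat m" by (rule assms)
  finally show "card G \<le> m" by simp
qed

lemma mesh_leD:
  assumes "mesh Y \<U> \<le> ennreal M" "0 \<le> M" "U \<in> \<U>" "x \<in> U" "y \<in> U"
  shows "mdist Y x y \<le> M"
proof -
  have "ennreal (mdist Y x y) \<le> ediam Y U"
    unfolding ediam_def using assms by (intro SUP_upper2[of x] SUP_upper2[of y]) auto
  also have "\<dots> \<le> mesh Y \<U>" unfolding mesh_def using assms by (intro SUP_upper)
  also have "\<dots> \<le> ennreal M" by (rule assms)
  finally show ?thesis using assms(2) by simp
qed

text \<open>The supremum in the Lebesgue number need not be attained, so the radius has to be
  strictly smaller.\<close>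

lemma lebesgue_number_ball:
  assumes "ennreal d \<le> lebesgue_number Y \<U>" "c < d" "0 < d" "y \<in> mspace Y"
  shows "\<exists>U\<in>\<U>. \<forall>x\<in>mspace Y. mdist Y y x \<le> c \<longrightarrow> x \<in> U"
proof -
  have "ennreal c < ennreal d" using assms by (simp add: ennreal_lessI)
  also have "\<dots> \<le> (SUP U\<in>\<U>. edist_set Y y (mspace Y - U))"
    using assms(1,4) unfolding lebesgue_number_def le_INF_iff by blast
  finally obtain U where U: "U \<in> \<U>" "ennreal c < edist_set Y y (mspace Y - U)"
    by (auto simp: less_SUP_iff)
  have "x \<in> U" if "x \<in> mspace Y" "mdist Y y x \<le> c" for x
  proof (rule ccontr)
    assume "x \<notin> U"
    then have "edist_set Y y (mspace Y - U) \<le> ennreal (mdist Y y x)"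
      unfolding edist_set_def using that by (intro INF_lower) auto
    also have "\<dots> \<le> ennreal c" using that by (intro ennreal_leI)
    finally show False using U(2) by simp
  qed
  then show ?thesis using U(1) by blast
qed

lemma radial_chartD:
  assumes "radial_chart X D C M h \<epsilon> \<tau> p" "\<xi> \<in> mspace D" "\<eta> \<in> mspace D" "r \<in> {0..h}" "s \<in> {0..h}"
  shows "\<bar>r - s\<bar> \<le> mdist X (p \<xi> r) (p \<eta> s)"
    and "mdist D \<xi> \<eta> \<le> \<epsilon> \<Longrightarrow> mdist X (p \<xi> r) (p \<eta> s) \<le> \<bar>r - s\<bar> + C"
    and "mdist X (p \<xi> r) (p \<eta> s) \<le> M \<Longrightarrow> mdist D \<xi> \<eta> \<le> \<tau>"
  using assms unfolding radial_chart_def by blast+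

lemma radial_chart_mono:
  assumes "radial_chart X D C M h \<epsilon> \<tau> p" "C \<le> C'" "\<epsilon>' \<le> \<epsilon>"
  shows "radial_chart X D C' M h \<epsilon>' \<tau> p"
  unfolding radial_chart_def
proof (intro conjI ballI impI)
  fix \<xi> r assume "\<xi> \<in> mspace D" "r \<in> {0..h}"
  then show "p \<xi> r \<in> mspace X" using assms(1) unfolding radial_chart_def by blast
next
  fix \<xi> \<eta> r s assume as: "\<xi> \<in> mspace D" "\<eta> \<in> mspace D" "r \<in> {0..h}" "s \<in> {0..h}"
  note D = radial_chartD[OF assms(1) as]
  show "\<bar>r - s\<bar> \<le> mdist X (p \<xi> r) (p \<eta> s)" by (rule D(1))
  show "mdist X (p \<xi> r) (p \<eta> s) \<le> \<bar>r - s\<bar> + C'" if "mdist D \<xi> \<eta> \<le> \<epsilon>'"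
    using D(2) that assms(2,3) by linarith
  show "mdist D \<xi> \<eta> \<le> \<tau>" if "mdist X (p \<xi> r) (p \<eta> s) \<le> M" by (rule D(3)[OF that])
qed

abbreviation cube_metric :: "'i set \<Rightarrow> ('i \<Rightarrow> real) metric" where
  "cube_metric I \<equiv> linf_prod I (\<lambda>i. submetric euclidean_metric {0..1::real})"

lemma mdist_boundary_cube_le_iff:
  assumes "finite I"
  shows "mdist (linf_prod2 (linf_prod I D) (cube_metric I)) z z' \<le> c \<longleftrightarrow>
    0 \<le> c \<and> (\<forall>i\<in>I. mdist (D i) (fst z i) (fst z' i) \<le> c \<and> \<bar>snd z i - snd z' i\<bar> \<le> c)"
  using assms by (auto simp: mdist_linf_prod2 mdist_linf_prod linf_dist_le_iff dist_real_def)

text \<open>The map \<open>F\<close> in the proof sends \<open>(\<xi>, t)\<close> to the point whose \<open>i\<close>-th coordinate lies on the ray to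
  \<open>\<xi> i\<close> at the height given by folding \<open>t i\<close> with period \<open>\<tau>\<close>.  It maps \<open>\<rho>\<close>-balls into
  balls of radius \<open>C + 1\<close>, hence into members of \<open>\<U>\<close>.  The preimage of a member \<open>U\<close> is thin in the
  boundary directions, but it repeats periodically in every cube direction.  As the heights range over an interval
  longer than the diameter of \<open>U\<close>, the set \<open>U\<close> misses the bottom or the top height in
  each coordinate, so its preimage can be cut at the values of \<open>t i\<close> that are folded to the missed
  height.  The pieces have diameter at most \<open>\<tau>\<close>, a ball inside the preimage is never cut, and
  every point lies in exactly one piece of each preimage containing it, so that the multiplicity does not grow.\<close>

proposition colored_covering_of_radial_charts:
  fixes X :: "'i \<Rightarrow> 'a metric" and D :: "'i \<Rightarrow> 'b metric" and I :: "'i set"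
  defines "Y \<equiv> linf_prod I X" and "Z \<equiv> linf_prod2 (linf_prod I D) (cube_metric I)"
  assumes fin: "finite I" and M: "0 \<le> M" and C: "0 \<le> C" and \<tau>: "0 < \<tau>" and m: "0 < m"
    and chart: "\<And>i. i \<in> I \<Longrightarrow> radial_chart (X i) (D i) C M (M + 1) \<epsilon> \<tau> (p i)"
    and mult: "multiplicity \<U> \<le> enat m"
    and mesh: "mesh Y \<U> \<le> ennreal M"
    and leb: "ennreal (C + 2) \<le> lebesgue_number Y \<U>"
    and \<rho>: "0 < \<rho>" "\<rho> \<le> \<epsilon>" "(M + 1) * pi / \<tau> * \<rho> \<le> 1"
  shows "\<exists>\<V>. open_covering Z \<V> \<and> colored m \<V> \<and> mesh Z \<V> \<le> ennreal \<tau> \<and>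
           ennreal (\<rho> / (2 * real m)) \<le> lebesgue_number Z \<V>"
proof -
  define r where "r = fold_height (M + 1) \<tau>"
  define F where "F = (\<lambda>z. \<lambda>i\<in>I. p i (fst z i) (r (snd z i)))"
  \<comment> \<open>The cuts are at the bottom, \<open>t / \<tau> \<in> \<int>\<close>, or at the top, \<open>t / \<tau> - 1 / 2 \<in> \<int>\<close>, whichever is missed;
    when both are, either choice is fine.\<close>
  define b :: "('i \<Rightarrow> 'a) set \<Rightarrow> 'i \<Rightarrow> real" where
    "b = (\<lambda>U i. if \<exists>z\<in>mspace Z. F z \<in> U \<and> snd z i / \<tau> \<in> \<int> then 1 / 2 else 0)"
  define V where "V = (\<lambda>(U, c). {z \<in> mspace Z. F z \<in> U \<and> (\<forall>i\<in>I. \<lfloor>snd z i / \<tau> - b U i\<rfloor> = (c i :: int))})"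
  define J where "J = \<U> \<times> Pi\<^sub>E I (\<lambda>_. UNIV :: int set)"
  have r: "r t \<in> {0..M + 1}" for t unfolding r_def using M by (intro fold_height_bounds) simp
  have r_lip: "\<bar>r s - r t\<bar> \<le> 1" if "\<bar>s - t\<bar> \<le> \<rho>" for s t
  proof -
    have "\<bar>r s - r t\<bar> \<le> (M + 1) * pi / \<tau> * \<bar>s - t\<bar>"
      unfolding r_def using M \<tau> by (intro fold_height_lipschitz) auto
    also have "\<dots> \<le> (M + 1) * pi / \<tau> * \<rho>" using that M \<tau> by (intro mult_left_mono) auto
    finally show ?thesis using \<rho>(3) by linarith
  qed
  have Z: "z \<in> mspace Z \<longleftrightarrow> fst z \<in> Pi\<^sub>E I (\<lambda>i. mspace (D i)) \<and> snd z \<in> Pi\<^sub>E I (\<lambda>_. {0..1})" for z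
    unfolding Z_def by (cases z) (simp add: mspace_linf_prod[OF fin])
  have Z_fst: "fst z i \<in> mspace (D i)" if "z \<in> mspace Z" "i \<in> I" for z i
    using that by (auto simp: Z)
  have dZ: "mdist Z z z' \<le> c \<longleftrightarrow>
      0 \<le> c \<and> (\<forall>i\<in>I. mdist (D i) (fst z i) (fst z' i) \<le> c \<and> \<bar>snd z i - snd z' i\<bar> \<le> c)" for z z' c
    unfolding Z_def by (rule mdist_boundary_cube_le_iff[OF fin])
  have dY: "mdist Y x y \<le> c \<longleftrightarrow> 0 \<le> c \<and> (\<forall>i\<in>I. mdist (X i) (x i) (y i) \<le> c)" for x y c
    unfolding Y_def by (simp add: mdist_linf_prod[OF fin] linf_dist_le_iff[OF fin])
  have FY: "F z \<in> mspace Y" if "z \<in> mspace Z" for z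
    unfolding Y_def mspace_linf_prod[OF fin]
  proof (rule PiE_I)
    show "F z i \<in> mspace (X i)" if "i \<in> I" for i
      using chart[OF that] Z_fst[OF \<open>z \<in> mspace Z\<close> that] r that
      unfolding radial_chart_def F_def by simp
  qed (simp add: F_def)
  have radial: "\<bar>r (snd z i) - r (snd z' i)\<bar> \<le> mdist (X i) (F z i) (F z' i)"
    and close: "mdist (D i) (fst z i) (fst z' i) \<le> \<epsilon> \<Longrightarrow>
        mdist (X i) (F z i) (F z' i) \<le> \<bar>r (snd z i) - r (snd z' i)\<bar> + C"
    and far: "mdist (X i) (F z i) (F z' i) \<le> M \<Longrightarrow> mdist (D i) (fst z i) (fst z' i) \<le> \<tau>"
    if "z \<in> mspace Z" "z' \<in> mspace Z" "i \<in> I" for z z' i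
    using radial_chartD[OF chart[OF that(3)] Z_fst[OF that(1,3)] Z_fst[OF that(2,3)] r r] that(3)
    unfolding F_def by simp_all
  have U_diam: "mdist (X i) (F z i) (F z' i) \<le> M" if "U \<in> \<U>" "F z \<in> U" "F z' \<in> U" "i \<in> I" for U z z' i
    using mesh_leD[OF mesh M that(1-3)] that(4) unfolding dY by blast
  have avoid: "snd z i / \<tau> - b U i \<notin> \<int>" if U: "U \<in> \<U>" "F z \<in> U" "z \<in> mspace Z" "i \<in> I" for U z i
  proof
    assume int: "snd z i / \<tau> - b U i \<in> \<int>"
    show False
    proof (cases "b U i = 0")
      case True
      then have "snd z i / \<tau> \<in> \<int>" using int by simp
      then have "b U i = 1 / 2" using U unfolding b_def by auto
      then show False using True by simp
    next
      case False
      then have half: "b U i = 1 / 2" unfolding b_def by (auto split: if_splits)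
      then obtain z' where z': "z' \<in> mspace Z" "F z' \<in> U" "snd z' i / \<tau> \<in> \<int>"
        unfolding b_def by (auto split: if_splits)
      have "r (snd z i) = M + 1"
        unfolding r_def using int half by (intro fold_height_at_half_int) simp
      moreover have "r (snd z' i) = 0" unfolding r_def by (rule fold_height_at_int[OF z'(3)])
      ultimately show False
        using radial[OF U(3) z'(1) U(4)] U_diam[OF U(1,2) z'(2) U(4)] M by simp
    qed
  qed
  show ?thesis
  proof (rule colored_open_covering_of_multiplicity[where I = J and V = V, OF \<rho>(1) m])
    fix z assume z: "z \<in> mspace Z"
    have "\<exists>U\<in>\<U>. \<forall>x\<in>mspace Y. mdist Y (F z) x \<le> C + 1 \<longrightarrow> x \<in> U"
      using C by (intro lebesgue_number_ball[OF leb _ _ FY[OF z]]) auto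
    then obtain U where U: "U \<in> \<U>" "\<And>x. x \<in> mspace Y \<Longrightarrow> mdist Y (F z) x \<le> C + 1 \<Longrightarrow> x \<in> U" by blast
    have FU: "F z' \<in> U" if z': "z' \<in> mspace Z" and le: "mdist Z z z' \<le> \<rho>" for z'
    proof (rule U(2)[OF FY[OF z']])
      have "mdist (X i) (F z i) (F z' i) \<le> C + 1" if i: "i \<in> I" for i
      proof -
        have "mdist (D i) (fst z i) (fst z' i) \<le> \<rho>" "\<bar>snd z i - snd z' i\<bar> \<le> \<rho>"
          using le i unfolding dZ by blast+
        then show ?thesis using close[OF z z' i] r_lip[of "snd z i" "snd z' i"] \<rho>(2) by linarith
      qed
      then show "mdist Y (F z) (F z') \<le> C + 1" unfolding dY using C by simp
    qed
    define c where "c = (\<lambda>i\<in>I. \<lfloor>snd z i / \<tau> - b U i\<rfloor>)"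
    have "z' \<in> V (U, c)" if z': "z' \<in> mspace Z" and lt: "mdist Z z z' < \<rho>" for z'
    proof -
      have "\<lfloor>snd z i / \<tau> - b U i\<rfloor> = \<lfloor>snd z' i / \<tau> - b U i\<rfloor>" if i: "i \<in> I" for i
      proof (rule ccontr)
        assume "\<not> ?thesis"
        then obtain w where w: "w \<in> \<int>"
            "w \<in> {min (snd z i / \<tau> - b U i) (snd z' i / \<tau> - b U i)..
                 max (snd z i / \<tau> - b U i) (snd z' i / \<tau> - b U i)}"
          using floor_neq_imp_int_between by blast
        define s where "s = \<tau> * (w + b U i)"
        have s_eq: "s / \<tau> - b U i = w" using \<tau> by (simp add: s_def)
        have "min (snd z i / \<tau>) (snd z' i / \<tau>) \<le> s / \<tau>" "s / \<tau> \<le> max (snd z i / \<tau>) (snd z' i / \<tau>)"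
          using w(2) unfolding s_eq[symmetric] by (auto simp: min_le_iff_disj le_max_iff_disj)
        then have s: "min (snd z i) (snd z' i) \<le> s" "s \<le> max (snd z i) (snd z' i)"
          using \<tau> by (auto simp: min_le_iff_disj le_max_iff_disj divide_le_cancel)
        have zi: "snd z i \<in> {0..1}" "snd z' i \<in> {0..1}" using z z' i by (auto simp: Z)
        have le: "0 \<le> \<rho>" "\<bar>snd z i - snd z' i\<bar> \<le> \<rho>" using lt i dZ[of z z' \<rho>] by auto
        \<comment> \<open>If \<open>z\<close> and \<open>z'\<close> were separated by a cut, moving a single coordinate of \<open>z\<close> onto
          the cut would give a point of the ball whose image lies in \<open>U\<close> at the height missed by \<open>U\<close>.\<close>
        define y where "y = (fst z, (snd z)(i := s))"
        have y: "y \<in> mspace Z"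
          using z zi s i unfolding Z y_def by (auto simp: PiE_iff extensional_def min_def max_def split: if_splits)
        have "\<bar>snd z i - s\<bar> \<le> \<rho>" using s le(2) by (auto simp: min_def max_def split: if_splits)
        then have "mdist Z z y \<le> \<rho>"
          using le(1) z Z_fst[OF z] unfolding dZ y_def by auto
        then have "snd y i / \<tau> - b U i \<notin> \<int>" by (intro avoid[OF U(1) FU[OF y] y i])
        then show False using s_eq w(1) by (simp add: y_def)
      qed
      then show ?thesis using FU[OF z'] lt z' by (simp add: V_def c_def)
    qed
    moreover have "(U, c) \<in> J" using U(1) by (simp add: J_def c_def)
    ultimately show "\<exists>j\<in>J. \<forall>z'\<in>mspace Z. mdist Z z z' < \<rho> \<longrightarrow> z' \<in> V j" by blast
  next
    fix z
    have inj: "inj_on fst {j \<in> J. z \<in> V j}"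
    proof (rule inj_onI)
      fix j j' assume j: "j \<in> {j \<in> J. z \<in> V j}" "j' \<in> {j \<in> J. z \<in> V j}" "fst j = fst j'"
      have "snd j = snd j'"
      proof (rule PiE_ext)
        show "snd j \<in> Pi\<^sub>E I (\<lambda>_. UNIV)" "snd j' \<in> Pi\<^sub>E I (\<lambda>_. UNIV)" using j by (auto simp: J_def)
        show "snd j i = snd j' i" if "i \<in> I" for i using j that by (auto simp: V_def)
      qed
      then show "j = j'" using j(3) by (simp add: prod_eq_iff)
    qed
    have sub: "fst ` {j \<in> J. z \<in> V j} \<subseteq> {U \<in> \<U>. F z \<in> U}" by (auto simp: J_def V_def)
    have fm: "finite {U \<in> \<U>. F z \<in> U}" "card {U \<in> \<U>. F z \<in> U} \<le> m"
      using multiplicity_leD[OF mult] by blast+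
    show "finite {j \<in> J. z \<in> V j} \<and> card {j \<in> J. z \<in> V j} \<le> m"
      using inj_on_finite[OF inj sub fm(1)] card_inj_on_le[OF inj sub fm(1)] fm(2) by simp
  next
    fix j z z' assume j: "j \<in> J" and z: "z \<in> V j" "z' \<in> V j"
    obtain U c where jU: "j = (U, c)" "U \<in> \<U>" using j by (auto simp: J_def)
    have zU: "z \<in> mspace Z" "z' \<in> mspace Z" "F z \<in> U" "F z' \<in> U"
      and cell: "\<And>i. i \<in> I \<Longrightarrow> \<lfloor>snd z i / \<tau> - b U i\<rfloor> = \<lfloor>snd z' i / \<tau> - b U i\<rfloor>"
      using z by (auto simp: V_def jU)
    show "mdist Z z z' \<le> \<tau>"
      unfolding dZ
    proof (intro conjI ballI)
      fix i assume i: "i \<in> I"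
      show "mdist (D i) (fst z i) (fst z' i) \<le> \<tau>" by (rule far[OF zU(1,2) i U_diam[OF jU(2) zU(3,4) i]])
      show "\<bar>snd z i - snd z' i\<bar> \<le> \<tau>" using floor_eq_imp_abs_diff_less[OF \<tau> cell[OF i]] by simp
    qed (use \<tau> in simp)
  qed
qed

section \<open>The dimension estimate\<close>

text \<open>One covering of the product of the \<open>X i\<close>, with Lebesgue number just above the errors of
  all charts, serves every scale \<open>\<tau>\<close>.  Only the charts move outwards as \<open>\<tau>\<close> shrinks, so the ratio between
  the Lebesgue number and the mesh of the pulled back coverings stays bounded below.\<close>

theorem ell_dim_boundary_cube_le_asdim:
  fixes X :: "'i \<Rightarrow> 'a metric" and D :: "'i \<Rightarrow> (nat \<Rightarrow> 'a) set metric" and I :: "'i set"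
  assumes fin: "finite I"
    and geo: "\<And>i. i \<in> I \<Longrightarrow> geodesic_metric (X i)"
    and hyp: "\<And>i. i \<in> I \<Longrightarrow> gromov_hyperbolic (X i)"
    and vis: "\<And>i. i \<in> I \<Longrightarrow> visual_metric (X i) (D i)"
  shows "ell_dim (linf_prod2 (linf_prod I D) (cube_metric I)) \<le> asdim (linf_prod I X)"
proof -
  let ?Y = "linf_prod I X" and ?Z = "linf_prod2 (linf_prod I D) (cube_metric I)"
  have "ell_dim ?Z \<le> enat k"
    if k: "\<And>d::real. d > 0 \<Longrightarrow> \<exists>\<U>. open_covering ?Y \<U> \<and> multiplicity \<U> \<le> enat (k + 1) \<and>
        mesh ?Y \<U> < \<infinity> \<and> lebesgue_number ?Y \<U> \<ge> ennreal d" for k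
  proof -
    have "\<forall>i\<in>I. \<exists>C\<ge>0. \<forall>M\<ge>0. \<forall>h>0. \<exists>\<kappa>>0. \<forall>\<^sub>F \<tau> in at_right 0.
        \<exists>p. radial_chart (X i) (D i) C M h (\<kappa> * \<tau>) \<tau> p"
      by (intro ballI ex_radial_chart geo hyp vis)
    from bchoice[OF this]
    obtain Ci where Ci: "\<forall>i\<in>I. 0 \<le> Ci i \<and> (\<forall>M\<ge>0. \<forall>h>0. \<exists>\<kappa>>0. \<forall>\<^sub>F \<tau> in at_right 0.
           \<exists>p. radial_chart (X i) (D i) (Ci i) M h (\<kappa> * \<tau>) \<tau> p)"
      by (elim exE)
    define C where "C = sum Ci I"
    have C: "0 \<le> C" using Ci by (auto simp: C_def intro!: sum_nonneg)
    have Ci_le: "Ci i \<le> C" if "i \<in> I" for i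
      unfolding C_def using that Ci fin by (intro member_le_sum) auto
    obtain \<U> where \<U>: "multiplicity \<U> \<le> enat (k + 1)" "mesh ?Y \<U> < \<infinity>"
        "ennreal (C + 2) \<le> lebesgue_number ?Y \<U>"
      using k[of "C + 2"] C by auto
    define M where "M = enn2real (mesh ?Y \<U>)"
    have M: "0 \<le> M" "mesh ?Y \<U> \<le> ennreal M" using \<U>(2) by (simp_all add: M_def)
    have "\<forall>i\<in>I. \<exists>\<kappa>>0. \<forall>\<^sub>F \<tau> in at_right 0.
        \<exists>p. radial_chart (X i) (D i) (Ci i) M (M + 1) (\<kappa> * \<tau>) \<tau> p"
    proof
      fix i assume "i \<in> I"
      with Ci have "\<forall>M\<ge>0. \<forall>h>0. \<exists>\<kappa>>0. \<forall>\<^sub>F \<tau> in at_right 0.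
          \<exists>p. radial_chart (X i) (D i) (Ci i) M h (\<kappa> * \<tau>) \<tau> p" by simp
      then show "\<exists>\<kappa>>0. \<forall>\<^sub>F \<tau> in at_right 0.
          \<exists>p. radial_chart (X i) (D i) (Ci i) M (M + 1) (\<kappa> * \<tau>) \<tau> p"
        using M(1) by simp
    qed
    from bchoice[OF this]
    obtain \<kappa>i where \<kappa>i: "\<forall>i\<in>I. 0 < \<kappa>i i \<and>
        (\<forall>\<^sub>F \<tau> in at_right 0.
           \<exists>p. radial_chart (X i) (D i) (Ci i) M (M + 1) (\<kappa>i i * \<tau>) \<tau> p)"
      by (elim exE)
    \<comment> \<open>The additional entry bounds by \<open>1\<close> the change of the folded height over a distance \<open>\<kappa> * \<tau>\<close>.\<close>
    define \<kappa> where "\<kappa> = Min (insert (1 / ((M + 1) * pi)) (\<kappa>i ` I))"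
    have \<kappa>: "0 < \<kappa>" "\<kappa> \<le> 1 / ((M + 1) * pi)" "\<And>i. i \<in> I \<Longrightarrow> \<kappa> \<le> \<kappa>i i"
      using fin \<kappa>i M(1) by (auto simp: \<kappa>_def)
    define \<delta> where "\<delta> = min (1 / 2) (\<kappa> / (2 * real (k + 1)))"
    have \<delta>: "0 < \<delta>" "\<delta> < 1" using \<kappa>(1) by (auto simp: \<delta>_def)
    have "\<forall>\<^sub>F \<tau> in at_right 0. \<forall>i\<in>I. \<exists>p. radial_chart (X i) (D i) (Ci i) M (M + 1) (\<kappa>i i * \<tau>) \<tau> p"
      using \<kappa>i by (intro eventually_ball_finite[OF fin]) simp
    moreover have "\<forall>\<^sub>F \<tau> in at_right 0. (0::real) < \<tau>" by (rule eventually_at_right_less)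
    ultimately have "\<forall>\<^sub>F \<tau> in at_right 0. \<exists>\<V>. open_covering ?Z \<V> \<and> colored (k + 1) \<V> \<and>
        mesh ?Z \<V> \<le> ennreal \<tau> \<and> lebesgue_number ?Z \<V> \<ge> ennreal (\<delta> * \<tau>)"
    proof eventually_elim
      case (elim \<tau>)
      from bchoice[OF elim(1)]
      obtain p where p: "\<forall>i\<in>I. radial_chart (X i) (D i) (Ci i) M (M + 1) (\<kappa>i i * \<tau>) \<tau> (p i)"
        by (elim exE)
      have chart: "radial_chart (X i) (D i) C M (M + 1) (\<kappa> * \<tau>) \<tau> (p i)" if "i \<in> I" for i
        using \<kappa>(3)[OF that] elim(2) by (intro radial_chart_mono[OF p[THEN bspec, OF that] Ci_le[OF that]]) simp
      have "(M + 1) * pi / \<tau> * (\<kappa> * \<tau>) = (M + 1) * pi * \<kappa>" using elim(2) by simp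
      also have "\<dots> \<le> 1"
      proof -
        have "0 < (M + 1) * pi" using M(1) by simp
        then show ?thesis using \<kappa>(2) by (simp add: pos_le_divide_eq mult.commute)
      qed
      finally have "\<exists>\<V>. open_covering ?Z \<V> \<and> colored (k + 1) \<V> \<and> mesh ?Z \<V> \<le> ennreal \<tau> \<and>
          ennreal (\<kappa> * \<tau> / (2 * real (k + 1))) \<le> lebesgue_number ?Z \<V>"
        using elim(2) \<kappa>(1)
        by (intro colored_covering_of_radial_charts[OF fin M(1) C elim(2) _ chart \<U>(1) M(2) \<U>(3)]) auto
      moreover have "ennreal (\<delta> * \<tau>) \<le> ennreal (\<kappa> * \<tau> / (2 * real (k + 1)))"
      proof (rule ennreal_leI)
        have "\<delta> * \<tau> \<le> \<kappa> / (2 * real (k + 1)) * \<tau>"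
          using elim(2) by (intro mult_right_mono) (auto simp: \<delta>_def)
        then show "\<delta> * \<tau> \<le> \<kappa> * \<tau> / (2 * real (k + 1))" by simp
      qed
      ultimately show ?case by (meson order_trans)
    qed
    then show ?thesis unfolding ell_dim_def using \<delta> by (intro Inf_lower) blast
  qed
  then show ?thesis unfolding asdim_def by (intro Inf_greatest) blast
qed

theorem theorem1p3:
  fixes n :: nat
    and X :: "nat \<Rightarrow> 'a metric"
    and D :: "nat \<Rightarrow> (nat \<Rightarrow> 'a) set metric"
  assumes "n \<ge> 1"
    and "\<And>i. i \<in> {1..n} \<Longrightarrow> geodesic_metric (X i)"
    and "\<And>i. i \<in> {1..n} \<Longrightarrow> gromov_hyperbolic (X i)"
    and "\<And>i. i \<in> {1..n} \<Longrightarrow> visual_metric (X i) (D i)"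
  shows "asdim (linf_prod {1..n} X) \<ge>
    ell_dim (linf_prod2 (linf_prod {1..n} D)
                        (linf_prod {1..n} (\<lambda>i. submetric euclidean_metric {0..1::real})))"
  by (rule ell_dim_boundary_cube_le_asdim[OF finite_atLeastAtMost assms(2-4)])

end
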